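(* Let $R$ be a left semihereditary ring and let $M$ be a finitely presented right $R$-module. Then $M=P\oplus N$ for some projective submodule $P$ of $M$ and some stable submodule $N$ of $M$ with $P\cong M^{**}$ and $N\cong \operatorname{Ext}^1_R(\operatorname{Tr}(M),R)$ as right $R$-modules.
   Context: Rings are associative with unity, modules are unital. A ring $R$ is left semihereditary if every finitely generated left ideal of $R$ is projective (as a left module). A module is called stable if it has no nonzero projective direct summand. For a right (or left) $R$-module $X$, $X^*=\operatorname{Hom}_R(X,R)$, which is a left (respectively right) $R$-module; $X^{**}=(X^* )^*$. Auslander-Bridger transpose: for a finitely presented right $R$-module $M$, take an exact sequence $\gamma: P_1\xrightarrow{f}P_0\xrightarrow{g}M\to 0$ with $P_0,P_1$ finitely generated projective right $R$-modules, and put $\operatorname{Tr}_\gamma(M)=\operatorname{Coker}(f^*:P_0^*\to P_1^* )$, a finitely presented left $R$-module. It is independent of $\gamma$ up to projective equivalence (left modules $A,B$ are projectively equivalent if $A\oplus P\cong B\oplus Q$ for some projective $P,Q$), so one writes $\operatorname{Tr}(M)$; the right $R$-module $\operatorname{Ext}^1_R(\operatorname{Tr}(M),R)$ (with right structure induced from the bimodule $R$) does not depend on $\gamma$ up to isomorphism. *)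

theory Defs
  imports "HOL-Algebra.AbelCoset" "HOL-Algebra.Module"
begin

text \<open>
  The locale \<open>module\<close> of HOL-Algebra requires commutative scalars; its record type and its
  locale \<open>submodule\<close> do not, and both are reused here. A right \<open>R\<close>-module is a left module over
  the opposite ring, so \<open>r \<odot> x\<close> in a right module is what one usually writes \<open>x r\<close>. The
  multiplicative fields of a module record, inherited from the ring record, carry no meaning.
\<close>

locale left_module = R?: ring R + M?: abelian_group M for R (structure) and M (structure) +
  assumes smult_closed [simp, intro]:
      "\<lbrakk>a \<in> carrier R; x \<in> carrier M\<rbrakk> \<Longrightarrow> a \<odot>\<^bsub>M\<^esub> x \<in> carrier M"
    and smult_l_distr:
      "\<lbrakk>a \<in> carrier R; b \<in> carrier R; x \<in> carrier M\<rbrakk> \<Longrightarrow>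
        (a \<oplus> b) \<odot>\<^bsub>M\<^esub> x = a \<odot>\<^bsub>M\<^esub> x \<oplus>\<^bsub>M\<^esub> b \<odot>\<^bsub>M\<^esub> x"
    and smult_r_distr:
      "\<lbrakk>a \<in> carrier R; x \<in> carrier M; y \<in> carrier M\<rbrakk> \<Longrightarrow>
        a \<odot>\<^bsub>M\<^esub> (x \<oplus>\<^bsub>M\<^esub> y) = a \<odot>\<^bsub>M\<^esub> x \<oplus>\<^bsub>M\<^esub> a \<odot>\<^bsub>M\<^esub> y"
    and smult_assoc1:
      "\<lbrakk>a \<in> carrier R; b \<in> carrier R; x \<in> carrier M\<rbrakk> \<Longrightarrow>
        (a \<otimes> b) \<odot>\<^bsub>M\<^esub> x = a \<odot>\<^bsub>M\<^esub> (b \<odot>\<^bsub>M\<^esub> x)"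
    and smult_one [simp]: "x \<in> carrier M \<Longrightarrow> \<one> \<odot>\<^bsub>M\<^esub> x = x"

definition op_ring :: "('a, 'r) ring_scheme \<Rightarrow> ('a, 'r) ring_scheme"
  where "op_ring R = R\<lparr>mult := \<lambda>x y. y \<otimes>\<^bsub>R\<^esub> x\<rparr>"

abbreviation right_module :: "('a, 'r) ring_scheme \<Rightarrow> ('a, 'b, 'm) module_scheme \<Rightarrow> bool"
  where "right_module R M \<equiv> left_module (op_ring R) M"

definition regular_module :: "('a, 'r) ring_scheme \<Rightarrow> ('a, 'a) module"
  where "regular_module R =
    \<lparr>carrier = carrier R, mult = mult R, one = one R, zero = zero R, add = add R,
     smult = mult R\<rparr>"

definition module_hom ::
  "('a, 'r) ring_scheme \<Rightarrow> ('a, 'b, 'm) module_scheme \<Rightarrow> ('a, 'c, 'n) module_scheme \<Rightarrow> ('b \<Rightarrow> 'c) set"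
  where "module_hom R X Y =
    {h \<in> carrier X \<rightarrow> carrier Y.
      (\<forall>x\<in>carrier X. \<forall>y\<in>carrier X. h (x \<oplus>\<^bsub>X\<^esub> y) = h x \<oplus>\<^bsub>Y\<^esub> h y) \<and>
      (\<forall>r\<in>carrier R. \<forall>x\<in>carrier X. h (r \<odot>\<^bsub>X\<^esub> x) = r \<odot>\<^bsub>Y\<^esub> h x)}"

definition module_isomorphic ::
  "('a, 'r) ring_scheme \<Rightarrow> ('a, 'b, 'm) module_scheme \<Rightarrow> ('a, 'c, 'n) module_scheme \<Rightarrow> bool"
  where "module_isomorphic R X Y \<longleftrightarrow>
    (\<exists>h\<in>module_hom R X Y. bij_betw h (carrier X) (carrier Y))"

definition direct_decomposition ::
  "('a, 'r) ring_scheme \<Rightarrow> ('a, 'b, 'm) module_scheme \<Rightarrow> 'b set \<Rightarrow> 'b set \<Rightarrow> bool"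
  where "direct_decomposition R M H K \<longleftrightarrow>
    submodule H R M \<and> submodule K R M \<and> H \<inter> K = {\<zero>\<^bsub>M\<^esub>} \<and> H <+>\<^bsub>M\<^esub> K = carrier M"

definition finitely_generated ::
  "('a, 'r) ring_scheme \<Rightarrow> ('a, 'b, 'm) module_scheme \<Rightarrow> bool"
  where "finitely_generated R M \<longleftrightarrow>
    (\<exists>A. finite A \<and> A \<subseteq> carrier M \<and> (\<forall>H. submodule H R M \<and> A \<subseteq> H \<longrightarrow> H = carrier M))"

definition free_module :: "('a, 'r) ring_scheme \<Rightarrow> 'i set \<Rightarrow> ('a, 'i \<Rightarrow> 'a) module"
  where "free_module R I =
    \<lparr>carrier = {f \<in> I \<rightarrow>\<^sub>E carrier R. finite {i \<in> I. f i \<noteq> \<zero>\<^bsub>R\<^esub>}},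
     mult = undefined, one = undefined,
     zero = (\<lambda>i\<in>I. \<zero>\<^bsub>R\<^esub>),
     add = (\<lambda>f g. \<lambda>i\<in>I. f i \<oplus>\<^bsub>R\<^esub> g i),
     smult = (\<lambda>r f. \<lambda>i\<in>I. r \<otimes>\<^bsub>R\<^esub> f i)\<rparr>"

text \<open>
  Projective: isomorphic to a direct summand of a free module. Drawing the index sets from the
  element type of \<open>P\<close> is no restriction: a direct summand of any free module is already one of
  the free module on the underlying set of \<open>P\<close>.
\<close>

definition projective_module ::
  "('a, 'r) ring_scheme \<Rightarrow> ('a, 'b, 'm) module_scheme \<Rightarrow> bool"
  where "projective_module R P \<longleftrightarrow>
    left_module R P \<and>
    (\<exists>(I :: 'b set) H K. direct_decomposition R (free_module R I) H K \<and>
       module_isomorphic R P ((free_module R I)\<lparr>carrier := H\<rparr>))"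

definition left_semihereditary :: "('a, 'r) ring_scheme \<Rightarrow> bool"
  where "left_semihereditary R \<longleftrightarrow>
    (\<forall>I. submodule I R (regular_module R) \<and>
         finitely_generated R ((regular_module R)\<lparr>carrier := I\<rparr>) \<longrightarrow>
         projective_module R ((regular_module R)\<lparr>carrier := I\<rparr>))"

definition stable_module ::
  "('a, 'r) ring_scheme \<Rightarrow> ('a, 'b, 'm) module_scheme \<Rightarrow> bool"
  where "stable_module R M \<longleftrightarrow>
    (\<forall>H K. direct_decomposition R M H K \<and> projective_module R (M\<lparr>carrier := H\<rparr>) \<longrightarrow>
       H = {\<zero>\<^bsub>M\<^esub>})"

text \<open>
  The dual of a left \<open>R\<close>-module \<open>X\<close> is the right \<open>R\<close>-module (left \<open>op_ring R\<close>-module) of all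
  homomorphisms from \<open>X\<close> to \<open>R\<close>, with scalars acting by \<open>(f r) x = f x r\<close>. The dual of a right
  \<open>R\<close>-module \<open>X\<close> is the left \<open>R\<close>-module \<open>dual_module (op_ring R) X\<close>, with \<open>(r f) x = r f x\<close>.
\<close>

definition dual_module ::
  "('a, 'r) ring_scheme \<Rightarrow> ('a, 'b, 'm) module_scheme \<Rightarrow> ('a, 'b \<Rightarrow> 'a) module"
  where "dual_module R X =
    \<lparr>carrier = module_hom R X (regular_module R) \<inter> extensional (carrier X),
     mult = undefined, one = undefined,
     zero = (\<lambda>x\<in>carrier X. \<zero>\<^bsub>R\<^esub>),
     add = (\<lambda>f g. \<lambda>x\<in>carrier X. f x \<oplus>\<^bsub>R\<^esub> g x),
     smult = (\<lambda>r f. \<lambda>x\<in>carrier X. f x \<otimes>\<^bsub>R\<^esub> r)\<rparr>"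

definition dual_map :: "('a, 'b, 'm) module_scheme \<Rightarrow> ('b \<Rightarrow> 'c) \<Rightarrow> ('c \<Rightarrow> 'a) \<Rightarrow> 'b \<Rightarrow> 'a"
  where "dual_map X h = (\<lambda>\<phi>. compose (carrier X) \<phi> h)"

definition quotient_module ::
  "('a, 'b, 'm) module_scheme \<Rightarrow> 'b set \<Rightarrow> ('a, 'b set) module"
  where "quotient_module M H =
    \<lparr>carrier = a_rcosets\<^bsub>M\<^esub> H,
     mult = undefined, one = undefined,
     zero = H,
     add = set_add M,
     smult = (\<lambda>r C. \<Union>x\<in>C. H +>\<^bsub>M\<^esub> (r \<odot>\<^bsub>M\<^esub> x))\<rparr>"

definition projective_presentation ::
  "('a, 'r) ring_scheme \<Rightarrow> ('a, 'p, 'm1) module_scheme \<Rightarrow> ('a, 'q, 'm0) module_scheme \<Rightarrow>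
   ('a, 'b, 'm) module_scheme \<Rightarrow> ('p \<Rightarrow> 'q) \<Rightarrow> ('q \<Rightarrow> 'b) \<Rightarrow> bool"
  where "projective_presentation R P1 P0 M f g \<longleftrightarrow>
    projective_module R P1 \<and> finitely_generated R P1 \<and>
    projective_module R P0 \<and> finitely_generated R P0 \<and>
    f \<in> module_hom R P1 P0 \<and> g \<in> module_hom R P0 M \<and>
    f ` carrier P1 = a_kernel P0 M g \<and> g ` carrier P0 = carrier M"

definition finitely_presented ::
  "('a, 'r) ring_scheme \<Rightarrow> ('a, 'b, 'm) module_scheme \<Rightarrow> bool"
  where "finitely_presented R M \<longleftrightarrow>
    (\<exists>(m::nat) (n::nat) f g.
       f \<in> module_hom R (free_module R {..<m}) (free_module R {..<n}) \<and>
       g \<in> module_hom R (free_module R {..<n}) M \<and>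
       f ` carrier (free_module R {..<m}) = a_kernel (free_module R {..<n}) M g \<and>
       g ` carrier (free_module R {..<n}) = carrier M)"

definition transpose_module ::
  "('a, 'r) ring_scheme \<Rightarrow> ('a, 'p, 'm1) module_scheme \<Rightarrow> ('a, 'q, 'm0) module_scheme \<Rightarrow>
   ('p \<Rightarrow> 'q) \<Rightarrow> ('a, ('p \<Rightarrow> 'a) set) module"
  where "transpose_module R P1 P0 f =
    quotient_module (dual_module R P1) (dual_map P1 f ` carrier (dual_module R P0))"

text \<open>
  The part \<open>Q2 \<rightarrow> Q1 \<rightarrow> Q0 \<rightarrow> X \<rightarrow> 0\<close> of a projective resolution of \<open>X\<close> that enters into
  \<open>Ext^1\<close>; it always extends to a full projective resolution.
\<close>

definition projective_resolution2 ::
  "('a, 'r) ring_scheme \<Rightarrow> ('a, 'q2, 'm2) module_scheme \<Rightarrow> ('a, 'q1, 'm1) module_scheme \<Rightarrow>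
   ('a, 'q0, 'm0) module_scheme \<Rightarrow> ('a, 'b, 'm) module_scheme \<Rightarrow>
   ('q2 \<Rightarrow> 'q1) \<Rightarrow> ('q1 \<Rightarrow> 'q0) \<Rightarrow> ('q0 \<Rightarrow> 'b) \<Rightarrow> bool"
  where "projective_resolution2 R Q2 Q1 Q0 X d2 d1 e \<longleftrightarrow>
    projective_module R Q2 \<and> projective_module R Q1 \<and> projective_module R Q0 \<and>
    d2 \<in> module_hom R Q2 Q1 \<and> d1 \<in> module_hom R Q1 Q0 \<and> e \<in> module_hom R Q0 X \<and>
    d2 ` carrier Q2 = a_kernel Q1 Q0 d1 \<and>
    d1 ` carrier Q1 = a_kernel Q0 X e \<and>
    e ` carrier Q0 = carrier X"

text \<open>
  \<open>Ext^1_R(X, R)\<close> computed from such a resolution, as the cohomology at \<open>Q1*\<close> of the complex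
  \<open>Q0* \<rightarrow> Q1* \<rightarrow> Q2*\<close>; as a
  subquotient of \<open>Q1*\<close> it inherits the scalar action coming from the other side of the
  bimodule \<open>R\<close>.
\<close>

definition Ext1_self ::
  "('a, 'r) ring_scheme \<Rightarrow> ('a, 'q2, 'm2) module_scheme \<Rightarrow> ('a, 'q1, 'm1) module_scheme \<Rightarrow>
   ('a, 'q0, 'm0) module_scheme \<Rightarrow> ('q2 \<Rightarrow> 'q1) \<Rightarrow> ('q1 \<Rightarrow> 'q0) \<Rightarrow> ('a, ('q1 \<Rightarrow> 'a) set) module"
  where "Ext1_self R Q2 Q1 Q0 d2 d1 =
    quotient_module
      ((dual_module R Q1)\<lparr>carrier :=
         a_kernel (dual_module R Q1) (dual_module R Q2) (dual_map Q2 d2)\<rparr>)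
      (dual_map Q1 d1 ` carrier (dual_module R Q0))"

lemma op_op_ring [simp]: "op_ring (op_ring R) = R"
  by (simp add: op_ring_def)

lemma op_ring_simps [simp]:
  "carrier (op_ring R) = carrier R" "\<zero>\<^bsub>op_ring R\<^esub> = \<zero>\<^bsub>R\<^esub>" "\<one>\<^bsub>op_ring R\<^esub> = \<one>\<^bsub>R\<^esub>"
  "x \<oplus>\<^bsub>op_ring R\<^esub> y = x \<oplus>\<^bsub>R\<^esub> y" "x \<otimes>\<^bsub>op_ring R\<^esub> y = y \<otimes>\<^bsub>R\<^esub> x"
  by (simp_all add: op_ring_def)

lemma ring_op_ring:
  assumes "ring R"
  shows "ring (op_ring R)"
proof -
  interpret ring R by fact
  show ?thesis
    by (rule ringI; (rule abelian_groupI monoidI)?)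
      (auto simp: a_ac m_assoc l_distr r_distr intro: l_neg bexI[of _ "\<ominus>\<^bsub>R\<^esub> _"])
qed

lemma left_module_dual_module:
  assumes "left_module R X"
  shows "left_module (op_ring R) (dual_module R X)"
proof -
  interpret left_module R X by fact
  have op: "ring (op_ring R)"
    by (rule ring_op_ring) (rule R.ring_axioms)
  have ab: "abelian_group (dual_module R X)"
  proof (rule abelian_groupI)
    fix f assume f: "f \<in> carrier (dual_module R X)"
    show "\<exists>g\<in>carrier (dual_module R X). g \<oplus>\<^bsub>dual_module R X\<^esub> f = \<zero>\<^bsub>dual_module R X\<^esub>"
      using f
      by (intro bexI[of _ "\<lambda>x\<in>carrier X. \<ominus>\<^bsub>R\<^esub> f x"])
        (auto simp: dual_module_def module_hom_def regular_module_def Pi_iff R.l_neg R.r_minus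
          R.minus_add)
  qed (auto simp: dual_module_def module_hom_def regular_module_def Pi_iff R.a_ac R.r_distr
      extensional_def intro!: ext split: if_splits)
  show ?thesis
    by (intro left_module.intro op ab left_module_axioms.intro)
      (auto simp: dual_module_def module_hom_def regular_module_def Pi_iff R.l_distr R.r_distr
        R.m_assoc extensional_def intro!: ext)
qed

lemma left_module_quotient_module:
  assumes "left_module R X" and "submodule H R X"
  shows "left_module R (quotient_module X H)"
proof -
  interpret left_module R X by fact
  interpret H: submodule H R X by fact
  interpret H: abelian_subgroup H X
    by (rule abelian_subgroupI3) (auto intro: additive_subgroup.intro H.subgroup_axioms M.abelian_group_axioms)
  have carr: "C \<in> a_rcosets\<^bsub>X\<^esub> H \<longleftrightarrow> (\<exists>x\<in>carrier X. C = H +>\<^bsub>X\<^esub> x)" for C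
    by (auto simp: A_RCOSETS_defs a_r_coset_def r_coset_def)
  have smult: "(\<Union>y\<in>H +>\<^bsub>X\<^esub> x. H +>\<^bsub>X\<^esub> (r \<odot>\<^bsub>X\<^esub> y)) = H +>\<^bsub>X\<^esub> (r \<odot>\<^bsub>X\<^esub> x)"
    if r: "r \<in> carrier R" and x: "x \<in> carrier X" for r x
  proof -
    have eq: "H +>\<^bsub>X\<^esub> (r \<odot>\<^bsub>X\<^esub> y) = H +>\<^bsub>X\<^esub> (r \<odot>\<^bsub>X\<^esub> x)" if y: "y \<in> H +>\<^bsub>X\<^esub> x" for y
    proof -
      obtain h where h: "h \<in> H" "y = h \<oplus>\<^bsub>X\<^esub> x"
        using y by (auto simp: a_r_coset_def')
      have hX: "h \<in> carrier X" using h(1) by (rule H.a_Hcarr)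
      have "r \<odot>\<^bsub>X\<^esub> y = r \<odot>\<^bsub>X\<^esub> h \<oplus>\<^bsub>X\<^esub> r \<odot>\<^bsub>X\<^esub> x"
        using r x hX h(2) by (simp add: smult_r_distr)
      then have "r \<odot>\<^bsub>X\<^esub> y \<in> H +>\<^bsub>X\<^esub> (r \<odot>\<^bsub>X\<^esub> x)"
        using H.smult_closed[OF r h(1)] by (auto simp: a_r_coset_def')
      then show ?thesis
        using H.a_repr_independence' r x by (metis smult_closed)
    qed
    have "x \<in> H +>\<^bsub>X\<^esub> x" using x by (rule H.a_rcos_self)
    then show ?thesis using eq by blast
  qed
  have add: "(H +>\<^bsub>X\<^esub> x) <+>\<^bsub>X\<^esub> (H +>\<^bsub>X\<^esub> y) = H +>\<^bsub>X\<^esub> (x \<oplus>\<^bsub>X\<^esub> y)"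
    if "x \<in> carrier X" "y \<in> carrier X" for x y
    using that by (rule H.a_rcos_sum)
  have zero: "H = H +>\<^bsub>X\<^esub> \<zero>\<^bsub>X\<^esub>"
    using M.a_coset_add_zero[OF H.a_subset] by simp
  have add0: "H <+>\<^bsub>X\<^esub> (H +>\<^bsub>X\<^esub> y) = H +>\<^bsub>X\<^esub> y" if "y \<in> carrier X" for y
    using add[of "\<zero>\<^bsub>X\<^esub>" y] that by (simp flip: zero)
  have ab: "abelian_group (quotient_module X H)"
  proof (rule abelian_groupI)
    show "\<zero>\<^bsub>quotient_module X H\<^esub> \<in> carrier (quotient_module X H)"
      using zero by (auto simp: quotient_module_def carr)
    fix C assume "C \<in> carrier (quotient_module X H)"
    then obtain x where x: "x \<in> carrier X" "C = H +>\<^bsub>X\<^esub> x"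
      by (auto simp: quotient_module_def carr)
    have "(H +>\<^bsub>X\<^esub> (\<ominus>\<^bsub>X\<^esub> x)) <+>\<^bsub>X\<^esub> C = H"
      using x by (simp add: add M.l_neg flip: zero)
    then show "\<exists>D\<in>carrier (quotient_module X H).
        D \<oplus>\<^bsub>quotient_module X H\<^esub> C = \<zero>\<^bsub>quotient_module X H\<^esub>"
      using x(1) by (intro bexI[of _ "H +>\<^bsub>X\<^esub> (\<ominus>\<^bsub>X\<^esub> x)"]) (auto simp: quotient_module_def carr)
  qed (auto simp: quotient_module_def carr add add0 M.a_ac)
  have ex: "\<exists>x\<in>carrier X. C = H +>\<^bsub>X\<^esub> x" if "C \<in> carrier (quotient_module X H)" for C
    using that by (simp add: quotient_module_def carr)
  show ?thesis
  proof (intro left_module.intro R.ring_axioms ab left_module_axioms.intro)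
    fix a b C D
    assume a: "a \<in> carrier R" and b: "b \<in> carrier R"
      and C: "C \<in> carrier (quotient_module X H)" and D: "D \<in> carrier (quotient_module X H)"
    obtain x where x: "x \<in> carrier X" "C = H +>\<^bsub>X\<^esub> x" using ex[OF C] ..
    obtain y where y: "y \<in> carrier X" "D = H +>\<^bsub>X\<^esub> y" using ex[OF D] ..
    note defs = quotient_module_def add smult a b x y
    show "a \<odot>\<^bsub>quotient_module X H\<^esub> C \<in> carrier (quotient_module X H)"
      using a x(1) by (auto simp: defs carr intro!: bexI[of _ "a \<odot>\<^bsub>X\<^esub> x"])
    show "(a \<oplus>\<^bsub>R\<^esub> b) \<odot>\<^bsub>quotient_module X H\<^esub> C =
        a \<odot>\<^bsub>quotient_module X H\<^esub> C \<oplus>\<^bsub>quotient_module X H\<^esub> b \<odot>\<^bsub>quotient_module X H\<^esub> C"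
      by (simp add: defs smult_l_distr)
    show "a \<odot>\<^bsub>quotient_module X H\<^esub> (C \<oplus>\<^bsub>quotient_module X H\<^esub> D) =
        a \<odot>\<^bsub>quotient_module X H\<^esub> C \<oplus>\<^bsub>quotient_module X H\<^esub> a \<odot>\<^bsub>quotient_module X H\<^esub> D"
      by (simp add: defs smult_r_distr)
    show "(a \<otimes>\<^bsub>R\<^esub> b) \<odot>\<^bsub>quotient_module X H\<^esub> C =
        a \<odot>\<^bsub>quotient_module X H\<^esub> (b \<odot>\<^bsub>quotient_module X H\<^esub> C)"
      by (simp add: defs smult_assoc1)
  next
    fix C assume "C \<in> carrier (quotient_module X H)"
    then obtain x where "x \<in> carrier X" "C = H +>\<^bsub>X\<^esub> x" using ex by blast
    then show "\<one>\<^bsub>R\<^esub> \<odot>\<^bsub>quotient_module X H\<^esub> C = C"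
      by (simp add: quotient_module_def smult)
  qed
qed

end

theory Submission
  imports Defs
begin

text \<open>
  Modules of one side over a ring \<open>R\<close> are treated throughout as left modules, so that the dual
  of an \<open>R\<close>-module is a module over \<open>op_ring R\<close>; the theorem is the case of right modules. Let
  \<open>N\<close> be the set of elements of \<open>M\<close> on which every functional vanishes
  (\<open>reject\<close>), that is, the kernel of the evaluation map \<open>M \<rightarrow> M**\<close>.

  The splitting comes from finitely many \<open>x\<^sub>i \<in> M\<close> and \<open>\<phi>\<^sub>i \<in> M*\<close> such that no functional
  distinguishes \<open>m\<close> from \<open>e m = \<Sum> \<phi>\<^sub>i(m) x\<^sub>i\<close> (\<open>evaluation_basis\<close>). Then \<open>e\<close> is an idempotent
  endomorphism of \<open>M\<close> with kernel \<open>N\<close>; its image \<open>P\<close> is projective because \<open>e x\<^sub>i\<close> and \<open>\<phi>\<^sub>i\<close> form a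
  dual basis of it, and evaluation maps \<open>P\<close> bijectively to \<open>M**\<close>, since a functional \<open>\<alpha>\<close> on \<open>M*\<close>
  is evaluation at \<open>\<Sum> \<alpha>(\<phi>\<^sub>i) x\<^sub>i\<close> (\<open>evaluation_basis_splits\<close>). As a summand of \<open>M\<close> that is killed
  by all functionals, \<open>N\<close> is stable (\<open>stable_reject\<close>).

  The elements \<open>x\<^sub>i\<close> and \<open>\<phi>\<^sub>i\<close> exist because of the hypothesis on the ring
  (\<open>finitely_presented_evaluation_basis\<close>). For a presentation \<open>G \<rightarrow> F \<rightarrow> M \<rightarrow> 0\<close> by finitely
  generated free modules, \<open>M*\<close> is the set of those functionals in \<open>F*\<close> that vanish on the images
  of the basis elements of \<open>G\<close>, hence a common kernel of finitely many functionals on the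
  finitely generated module \<open>F*\<close>. Over a semihereditary ring such a kernel is a direct summand,
  because the functionals can be split off one at a time
  (\<open>semihereditary_common_kernel_summand\<close>). The projection onto it turns the dual basis of \<open>F*\<close>
  into the \<open>\<phi>\<^sub>i\<close>.

  For a projective presentation \<open>P1 \<rightarrow> P0 \<rightarrow> M \<rightarrow> 0\<close> the sequence \<open>M* \<rightarrow> P0* \<rightarrow> P1* \<rightarrow> Tr M \<rightarrow> 0\<close>
  is exact and \<open>P0*\<close>, \<open>P1*\<close> are projective. Cocycles for it are the elements of
  \<open>P0** = P0\<close> that \<open>g\<close> sends into \<open>N\<close>, and coboundaries come from \<open>P1** = P1\<close>, so they are the
  kernel of \<open>g\<close>; this gives \<open>Ext\<^sup>1(Tr M, R) = N\<close>
  (\<open>reject_isomorphic_Ext1_dual_presentation\<close>). The usual comparison argument transfers this to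
  every other resolution (\<open>Ext1_self_independent\<close>).
\<close>

section \<open>Homomorphisms and submodules over a noncommutative ring\<close>

lemma module_homI:
  assumes "\<And>x. x \<in> carrier X \<Longrightarrow> h x \<in> carrier Y"
    and "\<And>x y. x \<in> carrier X \<Longrightarrow> y \<in> carrier X \<Longrightarrow> h (x \<oplus>\<^bsub>X\<^esub> y) = h x \<oplus>\<^bsub>Y\<^esub> h y"
    and "\<And>r x. r \<in> carrier R \<Longrightarrow> x \<in> carrier X \<Longrightarrow> h (r \<odot>\<^bsub>X\<^esub> x) = r \<odot>\<^bsub>Y\<^esub> h x"
  shows "h \<in> module_hom R X Y"
  using assms by (auto simp: module_hom_def)

lemma module_hom_closed: "h \<in> module_hom R X Y \<Longrightarrow> x \<in> carrier X \<Longrightarrow> h x \<in> carrier Y"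
  by (auto simp: module_hom_def)

lemma module_hom_add:
  "h \<in> module_hom R X Y \<Longrightarrow> x \<in> carrier X \<Longrightarrow> y \<in> carrier X \<Longrightarrow>
    h (x \<oplus>\<^bsub>X\<^esub> y) = h x \<oplus>\<^bsub>Y\<^esub> h y"
  by (auto simp: module_hom_def)

lemma module_hom_smult:
  "h \<in> module_hom R X Y \<Longrightarrow> r \<in> carrier R \<Longrightarrow> x \<in> carrier X \<Longrightarrow>
    h (r \<odot>\<^bsub>X\<^esub> x) = r \<odot>\<^bsub>Y\<^esub> h x"
  by (auto simp: module_hom_def)

lemma module_hom_id: "(\<lambda>x. x) \<in> module_hom R X X"
  by (auto simp: module_hom_def)

lemma module_hom_comp:
  "h \<in> module_hom R X Y \<Longrightarrow> k \<in> module_hom R Y Z \<Longrightarrow> (\<lambda>x. k (h x)) \<in> module_hom R X Z"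
  by (auto simp: module_hom_def Pi_iff)

lemma module_hom_cong:
  assumes "left_module R X" "h \<in> module_hom R X Y" "\<And>x. x \<in> carrier X \<Longrightarrow> k x = h x"
  shows "k \<in> module_hom R X Y"
proof -
  interpret left_module R X by fact
  show ?thesis using assms(2,3) by (auto simp: module_hom_def Pi_iff)
qed

lemma additive_zero:
  assumes "abelian_group X" "abelian_group Y" "f \<in> carrier X \<rightarrow> carrier Y"
    and "\<And>x y. x \<in> carrier X \<Longrightarrow> y \<in> carrier X \<Longrightarrow> f (x \<oplus>\<^bsub>X\<^esub> y) = f x \<oplus>\<^bsub>Y\<^esub> f y"
  shows "f \<zero>\<^bsub>X\<^esub> = \<zero>\<^bsub>Y\<^esub>"
proof -
  interpret X: abelian_group X by fact
  interpret Y: abelian_group Y by fact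
  have "f \<zero>\<^bsub>X\<^esub> \<oplus>\<^bsub>Y\<^esub> f \<zero>\<^bsub>X\<^esub> = f \<zero>\<^bsub>X\<^esub>"
    using assms(4)[of "\<zero>\<^bsub>X\<^esub>" "\<zero>\<^bsub>X\<^esub>"] by simp
  moreover have "f \<zero>\<^bsub>X\<^esub> \<in> carrier Y"
    using assms(3) by auto
  ultimately show ?thesis
    by (metis Y.add.r_cancel_one')
qed

lemma additive_finsum:
  assumes "abelian_group X" "abelian_group Y" "f \<in> carrier X \<rightarrow> carrier Y"
    and "\<And>x y. x \<in> carrier X \<Longrightarrow> y \<in> carrier X \<Longrightarrow> f (x \<oplus>\<^bsub>X\<^esub> y) = f x \<oplus>\<^bsub>Y\<^esub> f y"
    and "g \<in> A \<rightarrow> carrier X"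
  shows "f (finsum X g A) = finsum Y (\<lambda>i. f (g i)) A"
proof -
  interpret X: abelian_group X by fact
  interpret Y: abelian_group Y by fact
  have z: "f \<zero>\<^bsub>X\<^esub> = \<zero>\<^bsub>Y\<^esub>"
    using assms(1-4) by (rule additive_zero)
  show ?thesis
    using assms(5)
  proof (induction A rule: infinite_finite_induct)
    case (insert a A)
    then have "f (finsum X g (insert a A)) = f (g a) \<oplus>\<^bsub>Y\<^esub> f (finsum X g A)"
      by (simp add: assms(4) Pi_iff)
    also have "\<dots> = f (g a) \<oplus>\<^bsub>Y\<^esub> finsum Y (\<lambda>i. f (g i)) A"
      using insert by (simp add: Pi_iff)
    also have "\<dots> = finsum Y (\<lambda>i. f (g i)) (insert a A)"
      using insert assms(3) by (subst Y.finsum_insert) (auto simp: Pi_iff)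
    finally show ?case .
  qed (simp_all add: z)
qed

lemma module_hom_zero:
  assumes "left_module R X" "left_module R Y" "h \<in> module_hom R X Y"
  shows "h \<zero>\<^bsub>X\<^esub> = \<zero>\<^bsub>Y\<^esub>"
  using assms by (intro additive_zero) (auto simp: left_module_def module_hom_def)

lemma module_hom_finsum:
  assumes "left_module R X" "left_module R Y" "h \<in> module_hom R X Y" "g \<in> A \<rightarrow> carrier X"
  shows "h (finsum X g A) = finsum Y (\<lambda>i. h (g i)) A"
  using assms by (intro additive_finsum) (auto simp: left_module_def module_hom_def)

lemma module_hom_minus:
  assumes "left_module R X" "left_module R Y" "h \<in> module_hom R X Y" "x \<in> carrier X"
  shows "h (\<ominus>\<^bsub>X\<^esub> x) = \<ominus>\<^bsub>Y\<^esub> h x"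
proof -
  interpret X: left_module R X by fact
  interpret Y: left_module R Y by fact
  have "h (\<ominus>\<^bsub>X\<^esub> x) \<oplus>\<^bsub>Y\<^esub> h x = h (\<ominus>\<^bsub>X\<^esub> x \<oplus>\<^bsub>X\<^esub> x)"
    using assms(3,4) by (simp add: module_hom_add)
  then show ?thesis
    using assms by (simp add: X.M.l_neg module_hom_zero Y.M.minus_equality module_hom_closed)
qed

lemma module_hom_diff:
  assumes "left_module R X" "left_module R Y" "h \<in> module_hom R X Y"
    "x \<in> carrier X" "y \<in> carrier X"
  shows "h (x \<ominus>\<^bsub>X\<^esub> y) = h x \<ominus>\<^bsub>Y\<^esub> h y"
proof -
  interpret X: left_module R X by fact
  show ?thesis
    using assms by (simp add: a_minus_def module_hom_add module_hom_minus)
qed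

lemma (in left_module) smult_additive_finsum:
  assumes "r \<in> carrier R" "g \<in> A \<rightarrow> carrier M"
  shows "r \<odot>\<^bsub>M\<^esub> finsum M g A = finsum M (\<lambda>i. r \<odot>\<^bsub>M\<^esub> g i) A"
  by (rule additive_finsum) (use assms in \<open>auto simp: M.abelian_group_axioms smult_r_distr\<close>)

lemma (in left_module) smult_r_null [simp]:
  "r \<in> carrier R \<Longrightarrow> r \<odot>\<^bsub>M\<^esub> \<zero>\<^bsub>M\<^esub> = \<zero>\<^bsub>M\<^esub>"
  by (rule additive_zero) (auto simp: M.abelian_group_axioms smult_r_distr)

lemma (in left_module) smult_l_null [simp]:
  "x \<in> carrier M \<Longrightarrow> \<zero> \<odot>\<^bsub>M\<^esub> x = \<zero>\<^bsub>M\<^esub>"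
  by (rule additive_zero[where X = R])
    (auto simp: M.abelian_group_axioms R.abelian_group_axioms smult_l_distr)

lemma (in left_module) smult_l_minus_one:
  assumes "x \<in> carrier M"
  shows "(\<ominus> \<one>) \<odot>\<^bsub>M\<^esub> x = \<ominus>\<^bsub>M\<^esub> x"
proof -
  have "(\<ominus> \<one>) \<odot>\<^bsub>M\<^esub> x \<oplus>\<^bsub>M\<^esub> x = (\<ominus> \<one> \<oplus> \<one>) \<odot>\<^bsub>M\<^esub> x"
    using assms by (simp add: smult_l_distr)
  then show ?thesis
    using assms by (simp add: R.l_neg M.minus_equality)
qed

lemma module_hom_sum:
  assumes "left_module R X" "left_module R Y" "\<And>i. i \<in> A \<Longrightarrow> h i \<in> module_hom R X Y"
  shows "(\<lambda>x. finsum Y (\<lambda>i. h i x) A) \<in> module_hom R X Y"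
proof -
  interpret X: left_module R X by fact
  interpret Y: left_module R Y by fact
  note h = module_hom_closed[OF assms(3)] module_hom_add[OF assms(3)] module_hom_smult[OF assms(3)]
  show ?thesis
  proof (rule module_homI)
    fix x y assume xy: "x \<in> carrier X" "y \<in> carrier X"
    have "finsum Y (\<lambda>i. h i (x \<oplus>\<^bsub>X\<^esub> y)) A = finsum Y (\<lambda>i. h i x \<oplus>\<^bsub>Y\<^esub> h i y) A"
      using xy by (intro Y.M.finsum_cong') (auto simp: h)
    also have "\<dots> = finsum Y (\<lambda>i. h i x) A \<oplus>\<^bsub>Y\<^esub> finsum Y (\<lambda>i. h i y) A"
      using xy by (intro Y.M.finsum_addf) (auto simp: h)
    finally show "finsum Y (\<lambda>i. h i (x \<oplus>\<^bsub>X\<^esub> y)) A =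
        finsum Y (\<lambda>i. h i x) A \<oplus>\<^bsub>Y\<^esub> finsum Y (\<lambda>i. h i y) A" .
  next
    fix r x assume rx: "r \<in> carrier R" "x \<in> carrier X"
    have "finsum Y (\<lambda>i. h i (r \<odot>\<^bsub>X\<^esub> x)) A = finsum Y (\<lambda>i. r \<odot>\<^bsub>Y\<^esub> h i x) A"
      using rx by (intro Y.M.finsum_cong') (auto simp: h)
    also have "\<dots> = r \<odot>\<^bsub>Y\<^esub> finsum Y (\<lambda>i. h i x) A"
      using rx by (subst Y.smult_additive_finsum) (auto simp: h)
    finally show "finsum Y (\<lambda>i. h i (r \<odot>\<^bsub>X\<^esub> x)) A = r \<odot>\<^bsub>Y\<^esub> finsum Y (\<lambda>i. h i x) A" .
  qed (auto simp: h)
qed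

lemma module_hom_pointwise_diff:
  assumes "left_module R X" "left_module R Y" "h \<in> module_hom R X Y" "k \<in> module_hom R X Y"
  shows "(\<lambda>x. h x \<ominus>\<^bsub>Y\<^esub> k x) \<in> module_hom R X Y"
proof -
  interpret X: left_module R X by fact
  interpret Y: left_module R Y by fact
  have neg: "\<ominus>\<^bsub>Y\<^esub> (r \<odot>\<^bsub>Y\<^esub> y) = r \<odot>\<^bsub>Y\<^esub> (\<ominus>\<^bsub>Y\<^esub> y)" if "r \<in> carrier R" "y \<in> carrier Y" for r y
    using that Y.smult_r_distr[of r "\<ominus>\<^bsub>Y\<^esub> y" y]
    by (intro Y.M.minus_equality) (auto simp: Y.M.l_neg)
  show ?thesis
  proof (rule module_homI)
    fix x y assume xy: "x \<in> carrier X" "y \<in> carrier X"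
    have *: "h x \<in> carrier Y" "h y \<in> carrier Y" "k x \<in> carrier Y" "k y \<in> carrier Y"
      using assms xy by (auto simp: module_hom_closed)
    show "h (x \<oplus>\<^bsub>X\<^esub> y) \<ominus>\<^bsub>Y\<^esub> k (x \<oplus>\<^bsub>X\<^esub> y) = h x \<ominus>\<^bsub>Y\<^esub> k x \<oplus>\<^bsub>Y\<^esub> (h y \<ominus>\<^bsub>Y\<^esub> k y)"
      using assms xy * by (simp add: module_hom_add a_minus_def Y.M.minus_add Y.M.a_ac)
  next
    fix r x assume rx: "r \<in> carrier R" "x \<in> carrier X"
    show "h (r \<odot>\<^bsub>X\<^esub> x) \<ominus>\<^bsub>Y\<^esub> k (r \<odot>\<^bsub>X\<^esub> x) = r \<odot>\<^bsub>Y\<^esub> (h x \<ominus>\<^bsub>Y\<^esub> k x)"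
      using assms rx
      by (simp add: module_hom_smult a_minus_def Y.smult_r_distr module_hom_closed neg)
  qed (use assms in \<open>auto simp: module_hom_closed\<close>)
qed

lemma submoduleI:
  assumes "left_module R X" "H \<subseteq> carrier X" "\<zero>\<^bsub>X\<^esub> \<in> H"
    and "\<And>x y. x \<in> H \<Longrightarrow> y \<in> H \<Longrightarrow> x \<oplus>\<^bsub>X\<^esub> y \<in> H"
    and "\<And>r x. r \<in> carrier R \<Longrightarrow> x \<in> H \<Longrightarrow> r \<odot>\<^bsub>X\<^esub> x \<in> H"
  shows "submodule H R X"
proof -
  interpret left_module R X by fact
  have "\<ominus>\<^bsub>X\<^esub> x \<in> H" if "x \<in> H" for x
    using that assms(2) assms(5)[of "\<ominus>\<^bsub>R\<^esub> \<one>\<^bsub>R\<^esub>" x] by (auto simp: smult_l_minus_one)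
  then show ?thesis
    using assms by (intro submodule.intro subgroup.intro submodule_axioms.intro)
      (simp_all add: a_inv_def)
qed

lemma submoduleD:
  assumes "submodule H R X"
  shows "H \<subseteq> carrier X" "\<zero>\<^bsub>X\<^esub> \<in> H"
    and "\<And>x y. x \<in> H \<Longrightarrow> y \<in> H \<Longrightarrow> x \<oplus>\<^bsub>X\<^esub> y \<in> H"
    and "\<And>r x. r \<in> carrier R \<Longrightarrow> x \<in> H \<Longrightarrow> r \<odot>\<^bsub>X\<^esub> x \<in> H"
    and "\<And>x. x \<in> H \<Longrightarrow> \<ominus>\<^bsub>X\<^esub> x \<in> H"
proof -
  interpret submodule H R X by fact
  show "H \<subseteq> carrier X" "\<zero>\<^bsub>X\<^esub> \<in> H" using subset one_closed by auto
  show "x \<oplus>\<^bsub>X\<^esub> y \<in> H" if "x \<in> H" "y \<in> H" for x y using m_closed[OF that] by simp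
  show "r \<odot>\<^bsub>X\<^esub> x \<in> H" if "r \<in> carrier R" "x \<in> H" for r x using that by (rule smult_closed)
  show "\<ominus>\<^bsub>X\<^esub> x \<in> H" if "x \<in> H" for x using m_inv_closed[OF that] by (simp add: a_inv_def)
qed

lemma submodule_finsum:
  assumes "left_module R X" "submodule H R X" "g \<in> A \<rightarrow> H"
  shows "finsum X g A \<in> H"
proof -
  interpret left_module R X by fact
  note H = submoduleD[OF assms(2)]
  show ?thesis
    using assms(3)
  proof (induction A rule: infinite_finite_induct)
    case (insert a A)
    then have "g \<in> A \<rightarrow> carrier X" "g a \<in> carrier X" using H(1) by auto
    with insert show ?case using H(3) by (auto simp: Pi_iff)
  qed (use H in auto)
qed

lemma left_module_submodule:
  assumes "left_module R X" "submodule H R X"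
  shows "left_module R (X\<lparr>carrier := H\<rparr>)"
proof -
  interpret left_module R X by fact
  note H = submoduleD[OF assms(2)]
  have car: "x \<in> carrier X" if "x \<in> H" for x using that H(1) by auto
  have neg: "\<exists>y\<in>H. x \<oplus>\<^bsub>X\<^esub> y = \<zero>\<^bsub>X\<^esub>" if "x \<in> H" for x
    using H(5)[OF that] M.r_neg[OF car[OF that]] by blast
  show ?thesis
    by (intro left_module.intro R.ring_axioms abelian_groupI left_module_axioms.intro)
      (use H(2-4) in \<open>auto simp: car neg M.a_ac smult_l_distr smult_r_distr smult_assoc1\<close>)
qed

lemma module_hom_inclusion: "H \<subseteq> carrier X \<Longrightarrow> (\<lambda>x. x) \<in> module_hom R (X\<lparr>carrier := H\<rparr>) X"
  by (auto simp: module_hom_def)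

lemma submodule_image:
  assumes "left_module R X" "left_module R Y" "h \<in> module_hom R X Y"
  shows "submodule (h ` carrier X) R Y"
proof -
  interpret X: left_module R X by fact
  show ?thesis
    using assms
    by (intro submoduleI)
      (auto simp: module_hom_closed simp flip: module_hom_add module_hom_smult
        intro!: image_eqI[OF module_hom_zero[symmetric]])
qed

lemma submodule_vimage:
  assumes "left_module R X" "left_module R Y" "h \<in> module_hom R X Y" "submodule H R Y"
  shows "submodule {x \<in> carrier X. h x \<in> H} R X"
proof -
  interpret X: left_module R X by fact
  show ?thesis
    using assms submoduleD[OF assms(4)]
    by (intro submoduleI) (auto simp: module_hom_add module_hom_smult module_hom_zero)
qed

lemma submodule_zero: "left_module R X \<Longrightarrow> submodule {\<zero>\<^bsub>X\<^esub>} R X"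
proof -
  assume "left_module R X"
  then interpret left_module R X .
  show ?thesis by (intro submoduleI \<open>left_module R X\<close>) auto
qed

lemma submodule_kernel:
  assumes "left_module R X" "left_module R Y" "h \<in> module_hom R X Y"
  shows "submodule (a_kernel X Y h) R X"
  using submodule_vimage[OF assms submodule_zero[OF assms(2)]] by (simp add: a_kernel_def')

lemma (in abelian_group) minus_eq_zero_iff:
  assumes "x \<in> carrier G" "y \<in> carrier G"
  shows "x \<ominus> y = \<zero> \<longleftrightarrow> x = y"
  using assms by (metis a_minus_def add.inv_closed minus_equality minus_minus r_neg)

lemma module_hom_eq_iff_diff_in_kernel:
  assumes "left_module R X" "left_module R Y" "h \<in> module_hom R X Y"
    "x \<in> carrier X" "y \<in> carrier X"
  shows "h x = h y \<longleftrightarrow> x \<ominus>\<^bsub>X\<^esub> y \<in> a_kernel X Y h"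
proof -
  interpret X: left_module R X by fact
  interpret Y: left_module R Y by fact
  show ?thesis
    using assms module_hom_closed[OF assms(3)]
    by (auto simp: a_kernel_def' module_hom_diff[OF assms(1-3)] Y.M.minus_eq_zero_iff)
qed

lemma module_hom_inj_onI:
  assumes "left_module R X" "left_module R Y" "h \<in> module_hom R X Y"
    and "\<And>x. x \<in> carrier X \<Longrightarrow> h x = \<zero>\<^bsub>Y\<^esub> \<Longrightarrow> x = \<zero>\<^bsub>X\<^esub>"
  shows "inj_on h (carrier X)"
proof (rule inj_onI)
  interpret X: left_module R X by fact
  fix x y assume xy: "x \<in> carrier X" "y \<in> carrier X" "h x = h y"
  then have "x \<ominus>\<^bsub>X\<^esub> y = \<zero>\<^bsub>X\<^esub>"
    using module_hom_eq_iff_diff_in_kernel[OF assms(1-3)] assms(4) by (auto simp: a_kernel_def')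
  then show "x = y" using xy by (simp add: X.M.minus_eq_zero_iff)
qed

lemma module_hom_inverse:
  assumes "left_module R X" "h \<in> module_hom R X Y" "bij_betw h (carrier X) (carrier Y)"
  shows "inv_into (carrier X) h \<in> module_hom R Y X"
proof -
  interpret X: left_module R X by fact
  let ?k = "inv_into (carrier X) h"
  have inj: "inj_on h (carrier X)" and im: "h ` carrier X = carrier Y"
    using assms(3) by (auto simp: bij_betw_def)
  have k: "?k y \<in> carrier X" "h (?k y) = y" if "y \<in> carrier Y" for y
    using that im by (auto simp: inv_into_into f_inv_into_f)
  show ?thesis
  proof (rule module_homI)
    fix y z assume "y \<in> carrier Y" "z \<in> carrier Y"
    then show "?k (y \<oplus>\<^bsub>Y\<^esub> z) = ?k y \<oplus>\<^bsub>X\<^esub> ?k z"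
      using k assms(2) by (intro inv_into_f_eq[OF inj]) (auto simp: module_hom_add)
  next
    fix r y assume "r \<in> carrier R" "y \<in> carrier Y"
    then show "?k (r \<odot>\<^bsub>Y\<^esub> y) = r \<odot>\<^bsub>X\<^esub> ?k y"
      using k assms(2) by (intro inv_into_f_eq[OF inj]) (auto simp: module_hom_smult)
  qed (rule k)
qed

lemma module_isomorphic_trans:
  "module_isomorphic R X Y \<Longrightarrow> module_isomorphic R Y Z \<Longrightarrow> module_isomorphic R X Z"
  unfolding module_isomorphic_def
  by (metis (no_types, lifting) ext bij_betw_trans comp_def module_hom_comp)

text \<open>
  A homomorphism that kills the kernel of a surjection \<open>g\<close> can be evaluated on any preimage
  under \<open>g\<close>.
\<close>

lemma module_hom_factors_through_surjection:
  assumes "left_module R X" "left_module R Y" "left_module R Z"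
    and "g \<in> module_hom R X Y" "g ` carrier X = carrier Y" "h \<in> module_hom R X Z"
    and "\<And>x. x \<in> a_kernel X Y g \<Longrightarrow> h x = \<zero>\<^bsub>Z\<^esub>"
  obtains k where "k \<in> module_hom R Y Z" "\<And>x. x \<in> carrier X \<Longrightarrow> k (g x) = h x"
proof -
  interpret X: left_module R X by fact
  interpret Z: left_module R Z by fact
  define s where "s = inv_into (carrier X) g"
  have s: "s y \<in> carrier X" "g (s y) = y" if "y \<in> carrier Y" for y
    using that assms(5) by (auto simp: s_def inv_into_into f_inv_into_f)
  have eq: "h x = h x'" if "x \<in> carrier X" "x' \<in> carrier X" "g x = g x'" for x x'
    using that assms(7) module_hom_eq_iff_diff_in_kernel[OF assms(1,2,4)]
      module_hom_eq_iff_diff_in_kernel[OF assms(1,3,6)]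
    by (auto simp: a_kernel_def')
  have "(\<lambda>y. h (s y)) \<in> module_hom R Y Z"
  proof (rule module_homI)
    fix y z assume yz: "y \<in> carrier Y" "z \<in> carrier Y"
    then have c: "y \<oplus>\<^bsub>Y\<^esub> z \<in> carrier Y"
      using assms(2) by (simp add: left_module_def abelian_group_def abelian_monoid.a_closed)
    have "h (s (y \<oplus>\<^bsub>Y\<^esub> z)) = h (s y \<oplus>\<^bsub>X\<^esub> s z)"
      using yz c s assms(4) by (intro eq) (auto simp: module_hom_add)
    then show "h (s (y \<oplus>\<^bsub>Y\<^esub> z)) = h (s y) \<oplus>\<^bsub>Z\<^esub> h (s z)"
      using yz s assms(6) by (simp add: module_hom_add)
  next
    fix r y assume ry: "r \<in> carrier R" "y \<in> carrier Y"
    have c: "r \<odot>\<^bsub>Y\<^esub> y \<in> carrier Y" using left_module.smult_closed[OF assms(2) ry] .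
    have "h (s (r \<odot>\<^bsub>Y\<^esub> y)) = h (r \<odot>\<^bsub>X\<^esub> s y)"
      using ry c s assms(4) by (intro eq) (auto simp: module_hom_smult)
    then show "h (s (r \<odot>\<^bsub>Y\<^esub> y)) = r \<odot>\<^bsub>Z\<^esub> h (s y)"
      using ry s assms(6) by (simp add: module_hom_smult)
  qed (use s assms(6) in \<open>auto simp: module_hom_closed\<close>)
  moreover have "h (s (g x)) = h x" if "x \<in> carrier X" for x
    using that s assms(4) by (intro eq) (auto simp: module_hom_closed)
  ultimately show thesis by (rule that)
qed

lemma kernel_coset_eq_fibre:
  assumes "left_module R X" "left_module R Y" "k \<in> module_hom R X Y" "x \<in> carrier X"
  shows "a_kernel X Y k +>\<^bsub>X\<^esub> x = {x' \<in> carrier X. k x' = k x}"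
proof -
  interpret X: left_module R X by fact
  interpret Y: left_module R Y by fact
  have k: "k z \<in> carrier Y" if "z \<in> carrier X" for z
    using assms(3) that by (rule module_hom_closed)
  show ?thesis
  proof (intro equalityI subsetI)
    fix x' assume "x' \<in> {x' \<in> carrier X. k x' = k x}"
    then have x': "x' \<in> carrier X" "x' \<ominus>\<^bsub>X\<^esub> x \<in> a_kernel X Y k"
      using assms module_hom_eq_iff_diff_in_kernel[OF assms(1-3)] by auto
    have "x' = (x' \<ominus>\<^bsub>X\<^esub> x) \<oplus>\<^bsub>X\<^esub> x"
      using x'(1) assms(4) by (simp add: a_minus_def X.M.a_assoc X.M.l_neg)
    with x'(2) show "x' \<in> a_kernel X Y k +>\<^bsub>X\<^esub> x" by (auto simp: a_r_coset_def')
  qed (use assms k in \<open>auto simp: a_r_coset_def' a_kernel_def' module_hom_add\<close>)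
qed

text \<open>
  The first isomorphism theorem. The isomorphism sends \<open>y\<close> to its fibre, which is a coset of
  the kernel; no representatives have to be chosen.
\<close>

lemma first_isomorphism:
  assumes "left_module R X" "left_module R Y" "k \<in> module_hom R X Y"
    and "k ` carrier X = carrier Y" "a_kernel X Y k = H"
  shows "module_isomorphic R Y (quotient_module X H)"
proof -
  interpret X: left_module R X by fact
  interpret Y: left_module R Y by fact
  have k: "k x \<in> carrier Y" if "x \<in> carrier X" for x
    using assms(3) that by (rule module_hom_closed)
  define F where "F = (\<lambda>y. {x \<in> carrier X. k x = y})"
  have coset: "H +>\<^bsub>X\<^esub> x = F (k x)" if "x \<in> carrier X" for x
    using kernel_coset_eq_fibre[OF assms(1-3) that] assms(5) by (simp add: F_def)
  have surj: "\<exists>x\<in>carrier X. y = k x" if "y \<in> carrier Y" for y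
    using that assms(4) by auto
  have add: "F (y \<oplus>\<^bsub>Y\<^esub> z) = F y <+>\<^bsub>X\<^esub> F z" if yz: "y \<in> carrier Y" "z \<in> carrier Y" for y z
  proof (intro equalityI subsetI)
    fix x assume x: "x \<in> F (y \<oplus>\<^bsub>Y\<^esub> z)"
    obtain a where a: "a \<in> carrier X" "y = k a" using surj yz by auto
    have "k (\<ominus>\<^bsub>X\<^esub> a \<oplus>\<^bsub>X\<^esub> x) = z"
      using x a yz assms
      by (simp add: F_def module_hom_add module_hom_minus k Y.M.r_neg1)
    then have "\<ominus>\<^bsub>X\<^esub> a \<oplus>\<^bsub>X\<^esub> x \<in> F z" "a \<in> F y" "x = a \<oplus>\<^bsub>X\<^esub> (\<ominus>\<^bsub>X\<^esub> a \<oplus>\<^bsub>X\<^esub> x)"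
      using x a by (auto simp: F_def X.M.r_neg2)
    then show "x \<in> F y <+>\<^bsub>X\<^esub> F z" by (auto simp: set_add_def')
  qed (use assms(3) in \<open>auto simp: set_add_def' F_def module_hom_add\<close>)
  have smult: "F (r \<odot>\<^bsub>Y\<^esub> y) = (\<Union>x\<in>F y. H +>\<^bsub>X\<^esub> (r \<odot>\<^bsub>X\<^esub> x))"
    if ry: "r \<in> carrier R" "y \<in> carrier Y" for r y
  proof -
    have "F y \<noteq> {}" using surj[OF ry(2)] by (auto simp: F_def)
    moreover have "H +>\<^bsub>X\<^esub> (r \<odot>\<^bsub>X\<^esub> x) = F (r \<odot>\<^bsub>Y\<^esub> y)" if "x \<in> F y" for x
      using that ry assms(3) by (simp add: coset F_def module_hom_smult)
    ultimately show ?thesis by auto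
  qed
  have "F \<in> module_hom R Y (quotient_module X H)"
    by (rule module_homI)
      (auto simp: quotient_module_def add smult A_RCOSETS_def' dest!: surj simp: coset)
  moreover have "bij_betw F (carrier Y) (carrier (quotient_module X H))"
  proof (rule bij_betwI')
    fix y z assume "y \<in> carrier Y" "z \<in> carrier Y"
    then show "F y = F z \<longleftrightarrow> y = z" using surj by (auto simp: F_def set_eq_iff)
  qed (auto simp: quotient_module_def A_RCOSETS_def' coset dest!: surj intro: k)
  ultimately show ?thesis by (auto simp: module_isomorphic_def)
qed

lemma quotient_projection:
  assumes "left_module R X" "submodule H R X"
  shows "(\<lambda>x. H +>\<^bsub>X\<^esub> x) \<in> module_hom R X (quotient_module X H)"
    and "(\<lambda>x. H +>\<^bsub>X\<^esub> x) ` carrier X = carrier (quotient_module X H)"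
    and "a_kernel X (quotient_module X H) (\<lambda>x. H +>\<^bsub>X\<^esub> x) = H"
proof -
  interpret left_module R X by fact
  interpret H: submodule H R X by fact
  interpret H: abelian_subgroup H X
    by (rule abelian_subgroupI3)
      (auto intro: additive_subgroup.intro H.subgroup_axioms M.abelian_group_axioms)
  have smult: "(\<Union>y\<in>H +>\<^bsub>X\<^esub> x. H +>\<^bsub>X\<^esub> (r \<odot>\<^bsub>X\<^esub> y)) = H +>\<^bsub>X\<^esub> (r \<odot>\<^bsub>X\<^esub> x)"
    if rx: "r \<in> carrier R" "x \<in> carrier X" for r x
  proof -
    have "H +>\<^bsub>X\<^esub> (r \<odot>\<^bsub>X\<^esub> y) = H +>\<^bsub>X\<^esub> (r \<odot>\<^bsub>X\<^esub> x)" if y: "y \<in> H +>\<^bsub>X\<^esub> x" for y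
    proof -
      obtain h where h: "h \<in> H" "y = h \<oplus>\<^bsub>X\<^esub> x" using y by (auto simp: a_r_coset_def')
      have "r \<odot>\<^bsub>X\<^esub> y = r \<odot>\<^bsub>X\<^esub> h \<oplus>\<^bsub>X\<^esub> r \<odot>\<^bsub>X\<^esub> x"
        using rx h H.a_Hcarr by (simp add: smult_r_distr)
      then have "r \<odot>\<^bsub>X\<^esub> y \<in> H +>\<^bsub>X\<^esub> (r \<odot>\<^bsub>X\<^esub> x)"
        using H.smult_closed[OF rx(1) h(1)] by (auto simp: a_r_coset_def')
      then show ?thesis using H.a_repr_independence' rx by (metis smult_closed)
    qed
    then show ?thesis using H.a_rcos_self[OF rx(2)] by blast
  qed
  show "(\<lambda>x. H +>\<^bsub>X\<^esub> x) \<in> module_hom R X (quotient_module X H)"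
    by (rule module_homI) (auto simp: quotient_module_def smult H.a_rcos_sum A_RCOSETS_def')
  show "(\<lambda>x. H +>\<^bsub>X\<^esub> x) ` carrier X = carrier (quotient_module X H)"
    by (auto simp: quotient_module_def A_RCOSETS_def')
  show "a_kernel X (quotient_module X H) (\<lambda>x. H +>\<^bsub>X\<^esub> x) = H"
    using M.a_coset_join2[OF _ H.subgroup_axioms] M.a_coset_join1[OF _ _ H.subgroup_axioms] H.a_subset
    by (auto simp: a_kernel_def' quotient_module_def dest: H.a_rcos_self)
qed

section \<open>Free and projective modules\<close>

lemma regular_module_simps [simp]:
  "carrier (regular_module R) = carrier R" "\<zero>\<^bsub>regular_module R\<^esub> = \<zero>\<^bsub>R\<^esub>"
  "x \<oplus>\<^bsub>regular_module R\<^esub> y = x \<oplus>\<^bsub>R\<^esub> y" "r \<odot>\<^bsub>regular_module R\<^esub> x = r \<otimes>\<^bsub>R\<^esub> x"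
  by (simp_all add: regular_module_def)

lemma finsum_regular_module [simp]: "finsum (regular_module R) = finsum R"
  by (intro ext) (simp add: finsum_def finprod_def regular_module_def)

lemma minus_regular_module [simp]: "x \<ominus>\<^bsub>regular_module R\<^esub> y = x \<ominus>\<^bsub>R\<^esub> y"
  by (simp add: a_minus_def a_inv_def m_inv_def regular_module_def)

lemma left_module_regular: "ring R \<Longrightarrow> left_module R (regular_module R)"
proof -
  assume "ring R"
  then interpret ring R .
  have neg: "\<exists>y\<in>carrier R. y \<oplus>\<^bsub>R\<^esub> x = \<zero>\<^bsub>R\<^esub>" if "x \<in> carrier R" for x
    using that by (meson a_inv_closed l_neg)
  show ?thesis
    by (intro left_module.intro left_module_axioms.intro abelian_groupI ring_axioms)
      (auto simp: l_distr r_distr m_assoc a_assoc neg intro: a_comm)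
qed

lemma ring_of_left_module: "left_module R X \<Longrightarrow> ring R"
  by (simp add: left_module_def)

lemma free_module_simps:
  "carrier (free_module R I) = {f \<in> I \<rightarrow>\<^sub>E carrier R. finite {i \<in> I. f i \<noteq> \<zero>\<^bsub>R\<^esub>}}"
  "\<zero>\<^bsub>free_module R I\<^esub> = (\<lambda>i\<in>I. \<zero>\<^bsub>R\<^esub>)"
  "f \<oplus>\<^bsub>free_module R I\<^esub> g = (\<lambda>i\<in>I. f i \<oplus>\<^bsub>R\<^esub> g i)"
  "r \<odot>\<^bsub>free_module R I\<^esub> f = (\<lambda>i\<in>I. r \<otimes>\<^bsub>R\<^esub> f i)"
  by (simp_all add: free_module_def)

lemma left_module_free_module:
  assumes "ring R"
  shows "left_module R (free_module R I)"
proof -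
  interpret ring R by fact
  let ?F = "free_module R I"
  have fin_add: "finite {i \<in> I. f i \<oplus>\<^bsub>R\<^esub> g i \<noteq> \<zero>\<^bsub>R\<^esub>}"
    if "finite {i \<in> I. f i \<noteq> \<zero>\<^bsub>R\<^esub>}" "finite {i \<in> I. g i \<noteq> \<zero>\<^bsub>R\<^esub>}" for f g
    using that
    by (rule_tac finite_subset[of _ "{i \<in> I. f i \<noteq> \<zero>\<^bsub>R\<^esub>} \<union> {i \<in> I. g i \<noteq> \<zero>\<^bsub>R\<^esub>}"]) auto
  have fin_smult: "finite {i \<in> I. r \<otimes>\<^bsub>R\<^esub> f i \<noteq> \<zero>\<^bsub>R\<^esub>}"
    if "finite {i \<in> I. f i \<noteq> \<zero>\<^bsub>R\<^esub>}" "r \<in> carrier R" for f r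
    using that(2) by (intro finite_subset[OF _ that(1)]) auto
  have neg: "\<exists>g\<in>carrier ?F. g \<oplus>\<^bsub>?F\<^esub> f = \<zero>\<^bsub>?F\<^esub>" if f: "f \<in> carrier ?F" for f
  proof
    have "{i \<in> I. \<ominus>\<^bsub>R\<^esub> f i \<noteq> \<zero>\<^bsub>R\<^esub>} \<subseteq> {i \<in> I. f i \<noteq> \<zero>\<^bsub>R\<^esub>}" by auto
    with f show "(\<lambda>i\<in>I. \<ominus>\<^bsub>R\<^esub> f i) \<in> carrier ?F"
      by (auto simp: free_module_simps PiE_iff cong: conj_cong intro: finite_subset)
    show "(\<lambda>i\<in>I. \<ominus>\<^bsub>R\<^esub> f i) \<oplus>\<^bsub>?F\<^esub> f = \<zero>\<^bsub>?F\<^esub>"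
      using f by (intro ext) (auto simp: free_module_simps PiE_iff l_neg)
  qed
  show ?thesis
    by (intro left_module.intro left_module_axioms.intro abelian_groupI ring_axioms neg)
      (auto simp: free_module_simps PiE_iff fin_add fin_smult l_distr r_distr m_assoc a_ac
        extensional_def restrict_def cong: conj_cong intro!: ext)
qed

lemma idempotent_decomposition:
  assumes "left_module R X" "e \<in> module_hom R X X" "\<And>x. x \<in> carrier X \<Longrightarrow> e (e x) = e x"
  shows "direct_decomposition R X (e ` carrier X) (a_kernel X X e)"
proof -
  interpret left_module R X by fact
  have e: "e x \<in> carrier X" if "x \<in> carrier X" for x
    using assms(2) that by (rule module_hom_closed)
  have "x \<in> e ` carrier X <+>\<^bsub>X\<^esub> a_kernel X X e" if x: "x \<in> carrier X" for x
  proof -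
    have "e (x \<ominus>\<^bsub>X\<^esub> e x) = e x \<ominus>\<^bsub>X\<^esub> e (e x)"
      using assms x e by (intro module_hom_diff) auto
    then have "x \<ominus>\<^bsub>X\<^esub> e x \<in> a_kernel X X e"
      using x e assms(3) by (simp add: a_kernel_def' M.minus_eq_zero_iff)
    moreover have "x = e x \<oplus>\<^bsub>X\<^esub> (x \<ominus>\<^bsub>X\<^esub> e x)"
      using x e by (simp add: a_minus_def M.a_lcomm M.r_neg)
    ultimately show ?thesis using x by (auto simp: set_add_def')
  qed
  moreover have "e ` carrier X <+>\<^bsub>X\<^esub> a_kernel X X e \<subseteq> carrier X"
    using e by (auto simp: set_add_def' a_kernel_def')
  moreover have "e ` carrier X \<inter> a_kernel X X e = {\<zero>\<^bsub>X\<^esub>}"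
    using assms module_hom_zero[OF assms(1,1,2)]
    by (auto simp: a_kernel_def' intro!: image_eqI[of _ e "\<zero>\<^bsub>X\<^esub>"])
  ultimately show ?thesis
    using submodule_image[OF assms(1,1,2)] submodule_kernel[OF assms(1,1,2)]
    by (auto simp: direct_decomposition_def)
qed

lemma (in abelian_group) sum_eq_imp_diff_eq:
  assumes c: "x \<in> carrier G" "x' \<in> carrier G" "y \<in> carrier G" "y' \<in> carrier G"
    and e: "x \<oplus> y = x' \<oplus> y'"
  shows "x \<ominus> x' = y' \<ominus> y"
proof -
  have "\<ominus> x' \<oplus> x = \<ominus> x' \<oplus> (x \<oplus> y) \<oplus> \<ominus> y"
    using c by (simp add: a_assoc r_neg)
  also have "\<dots> = y' \<ominus> y"
    unfolding e using c by (simp add: a_minus_def r_neg1)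
  finally show ?thesis using c by (simp add: a_minus_def a_comm[of x])
qed

lemma decomposition_projection:
  assumes "left_module R X" "direct_decomposition R X H K"
  obtains p where "p \<in> module_hom R X X" "\<And>x. x \<in> carrier X \<Longrightarrow> p x \<in> H"
    "\<And>x. x \<in> H \<Longrightarrow> p x = x"
proof -
  interpret left_module R X by fact
  have subm: "submodule H R X" "submodule K R X" and int: "H \<inter> K = {\<zero>\<^bsub>X\<^esub>}"
    and sum: "H <+>\<^bsub>X\<^esub> K = carrier X"
    using assms(2) by (auto simp: direct_decomposition_def)
  note H = submoduleD[OF subm(1)] and K = submoduleD[OF subm(2)]
  have car: "x \<in> H \<Longrightarrow> x \<in> carrier X" "x \<in> K \<Longrightarrow> x \<in> carrier X" for x
    using H(1) K(1) by auto
  have uniq: "h = h'"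
    if "h \<in> H" "h' \<in> H" "k \<in> K" "k' \<in> K" "h \<oplus>\<^bsub>X\<^esub> k = h' \<oplus>\<^bsub>X\<^esub> k'" for h h' k k'
  proof -
    have c: "h \<in> carrier X" "h' \<in> carrier X" "k \<in> carrier X" "k' \<in> carrier X"
      using that car by auto
    note eq = M.sum_eq_imp_diff_eq[OF c that(5)]
    have "h \<ominus>\<^bsub>X\<^esub> h' \<in> H" "k' \<ominus>\<^bsub>X\<^esub> k \<in> K"
      unfolding a_minus_def using that(1-4) by (auto intro: H(3,5) K(3,5))
    then have "h \<ominus>\<^bsub>X\<^esub> h' \<in> H \<inter> K" unfolding eq by simp
    then have "h \<ominus>\<^bsub>X\<^esub> h' = \<zero>\<^bsub>X\<^esub>" unfolding int by simp
    then show ?thesis using c by (simp add: M.minus_eq_zero_iff)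
  qed
  have "\<forall>x\<in>carrier X. \<exists>z. fst z \<in> H \<and> snd z \<in> K \<and> fst z \<oplus>\<^bsub>X\<^esub> snd z = x"
    by (auto simp: set_add_def' simp flip: sum)
  from bchoice[OF this] obtain z where z: "\<And>x. x \<in> carrier X \<Longrightarrow>
      fst (z x) \<in> H \<and> snd (z x) \<in> K \<and> fst (z x) \<oplus>\<^bsub>X\<^esub> snd (z x) = x"
    by auto
  define p q where "p x = fst (z x)" and "q x = snd (z x)" for x
  have p: "p x \<in> H" and q: "q x \<in> K" and pq: "p x \<oplus>\<^bsub>X\<^esub> q x = x" if "x \<in> carrier X" for x
    using z[OF that] by (simp_all add: p_def q_def)
  have p_eq: "p (h \<oplus>\<^bsub>X\<^esub> k) = h" if "h \<in> H" "k \<in> K" for h k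
  proof -
    have "h \<oplus>\<^bsub>X\<^esub> k \<in> carrier X" using that car by simp
    from uniq[OF p[OF this] that(1) q[OF this] that(2) pq[OF this]] show ?thesis .
  qed
  have hom: "p \<in> module_hom R X X"
  proof (rule module_homI)
    fix x y assume xy: "x \<in> carrier X" "y \<in> carrier X"
    note pH = p[OF xy(1)] p[OF xy(2)] and qK = q[OF xy(1)] q[OF xy(2)]
    have "x \<oplus>\<^bsub>X\<^esub> y = (p x \<oplus>\<^bsub>X\<^esub> q x) \<oplus>\<^bsub>X\<^esub> (p y \<oplus>\<^bsub>X\<^esub> q y)"
      by (simp only: pq[OF xy(1)] pq[OF xy(2)])
    also have "\<dots> = (p x \<oplus>\<^bsub>X\<^esub> p y) \<oplus>\<^bsub>X\<^esub> (q x \<oplus>\<^bsub>X\<^esub> q y)"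
      using car(1)[OF pH(1)] car(1)[OF pH(2)] car(2)[OF qK(1)] car(2)[OF qK(2)]
      by (simp add: M.a_ac)
    finally show "p (x \<oplus>\<^bsub>X\<^esub> y) = p x \<oplus>\<^bsub>X\<^esub> p y"
      using p_eq[OF H(3)[OF pH] K(3)[OF qK]] by simp
  next
    fix r x assume rx: "r \<in> carrier R" "x \<in> carrier X"
    note pH = p[OF rx(2)] and qK = q[OF rx(2)]
    have "r \<odot>\<^bsub>X\<^esub> p x \<oplus>\<^bsub>X\<^esub> r \<odot>\<^bsub>X\<^esub> q x = r \<odot>\<^bsub>X\<^esub> x"
      using smult_r_distr[OF rx(1) car(1)[OF pH] car(2)[OF qK]] pq[OF rx(2)] by simp
    then show "p (r \<odot>\<^bsub>X\<^esub> x) = r \<odot>\<^bsub>X\<^esub> p x"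
      using p_eq[OF H(4)[OF rx(1) pH] K(4)[OF rx(1) qK]] by simp
  qed (rule car(1)[OF p])
  have "p x = x" if "x \<in> H" for x
    using p_eq[OF that K(2)] M.r_zero[OF car(1)[OF that]] by simp
  with hom p show thesis by (rule that)
qed

text \<open>
  The dual basis form of projectivity: \<open>x = \<Sum> c\<^sub>i(x) b\<^sub>i\<close> with finitely many nonzero
  coordinates. The index type is arbitrary, which makes it independent of the element type of
  \<open>P\<close>.
\<close>

definition dual_basis ::
  "('a, 'r) ring_scheme \<Rightarrow> ('a, 'b, 'm) module_scheme \<Rightarrow> 'i set \<Rightarrow> ('i \<Rightarrow> 'b) \<Rightarrow> ('i \<Rightarrow> 'b \<Rightarrow> 'a) \<Rightarrow> bool"
  where "dual_basis R P I b c \<longleftrightarrow>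
    b \<in> I \<rightarrow> carrier P \<and> (\<forall>i\<in>I. c i \<in> module_hom R P (regular_module R)) \<and>
    (\<forall>x\<in>carrier P. finite {i \<in> I. c i x \<noteq> \<zero>\<^bsub>R\<^esub>} \<and>
      finsum P (\<lambda>i. c i x \<odot>\<^bsub>P\<^esub> b i) {i \<in> I. c i x \<noteq> \<zero>\<^bsub>R\<^esub>} = x)"

lemma dual_basisD:
  assumes "dual_basis R P I b c"
  shows "\<And>i. i \<in> I \<Longrightarrow> b i \<in> carrier P"
    and "\<And>i. i \<in> I \<Longrightarrow> c i \<in> module_hom R P (regular_module R)"
    and "\<And>i x. i \<in> I \<Longrightarrow> x \<in> carrier P \<Longrightarrow> c i x \<in> carrier R"
    and "\<And>x. x \<in> carrier P \<Longrightarrow> finite {i \<in> I. c i x \<noteq> \<zero>\<^bsub>R\<^esub>}"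
    and "\<And>x. x \<in> carrier P \<Longrightarrow>
      finsum P (\<lambda>i. c i x \<odot>\<^bsub>P\<^esub> b i) {i \<in> I. c i x \<noteq> \<zero>\<^bsub>R\<^esub>} = x"
proof -
  show "b i \<in> carrier P" if "i \<in> I" for i
    using assms that by (auto simp: dual_basis_def)
  show c: "c i \<in> module_hom R P (regular_module R)" if "i \<in> I" for i
    using assms that by (auto simp: dual_basis_def)
  show "c i x \<in> carrier R" if "i \<in> I" "x \<in> carrier P" for i x
    using module_hom_closed[OF c[OF that(1)] that(2)] by simp
qed (use assms in \<open>simp_all add: dual_basis_def\<close>)

lemma finsum_over_support:
  assumes "left_module R X" "y \<in> I \<rightarrow> carrier X" "a \<in> I \<rightarrow> carrier R"
    and "finite A" "{i \<in> I. a i \<noteq> \<zero>\<^bsub>R\<^esub>} \<subseteq> A" "A \<subseteq> I"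
  shows "finsum X (\<lambda>i. a i \<odot>\<^bsub>X\<^esub> y i) {i \<in> I. a i \<noteq> \<zero>\<^bsub>R\<^esub>} = finsum X (\<lambda>i. a i \<odot>\<^bsub>X\<^esub> y i) A"
proof -
  interpret left_module R X by fact
  have "y i \<in> carrier X" "a i \<in> carrier R" if "i \<in> A" for i
    using that assms(2,3,6) by auto
  then show ?thesis
    using assms(4-6) by (intro M.add.finprod_mono_neutral_cong_left) auto
qed

lemma dual_basis_finite_sum:
  assumes "left_module R P" "dual_basis R P I b c" "finite I" "x \<in> carrier P"
  shows "finsum P (\<lambda>i. c i x \<odot>\<^bsub>P\<^esub> b i) I = x"
proof -
  note D = dual_basisD[OF assms(2)]
  have "finsum P (\<lambda>i. c i x \<odot>\<^bsub>P\<^esub> b i) {i \<in> I. c i x \<noteq> \<zero>\<^bsub>R\<^esub>} =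
      finsum P (\<lambda>i. c i x \<odot>\<^bsub>P\<^esub> b i) I"
    using assms(3,4) D(1,3) by (intro finsum_over_support[OF assms(1)]) auto
  then show ?thesis
    unfolding D(5)[OF assms(4)] by (rule sym)
qed

lemma finite_dual_basisI:
  assumes "left_module R P" "finite I" "\<And>i. i \<in> I \<Longrightarrow> b i \<in> carrier P"
    and "\<And>i. i \<in> I \<Longrightarrow> c i \<in> module_hom R P (regular_module R)"
    and "\<And>x. x \<in> carrier P \<Longrightarrow> finsum P (\<lambda>i. c i x \<odot>\<^bsub>P\<^esub> b i) I = x"
  shows "dual_basis R P I b c"
  unfolding dual_basis_def
proof (intro conjI ballI)
  fix x assume x: "x \<in> carrier P"
  have c: "c i x \<in> carrier R" if "i \<in> I" for i
    using module_hom_closed[OF assms(4)[OF that] x] by simp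
  have "finsum P (\<lambda>i. c i x \<odot>\<^bsub>P\<^esub> b i) {i \<in> I. c i x \<noteq> \<zero>\<^bsub>R\<^esub>} =
      finsum P (\<lambda>i. c i x \<odot>\<^bsub>P\<^esub> b i) I"
    using assms(2,3) c by (intro finsum_over_support[OF assms(1)]) auto
  then show "finsum P (\<lambda>i. c i x \<odot>\<^bsub>P\<^esub> b i) {i \<in> I. c i x \<noteq> \<zero>\<^bsub>R\<^esub>} = x"
    unfolding assms(5)[OF x] .
qed (use assms(2-4) in auto)

lemma dual_basis_separates:
  assumes "left_module R P" "dual_basis R P I b c" "x \<in> carrier P"
    and "\<And>i. i \<in> I \<Longrightarrow> c i x = \<zero>\<^bsub>R\<^esub>"
  shows "x = \<zero>\<^bsub>P\<^esub>"
proof -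
  interpret left_module R P by fact
  have "{i \<in> I. c i x \<noteq> \<zero>\<^bsub>R\<^esub>} = {}" using assms(4) by auto
  with dual_basisD(5)[OF assms(2,3)] show ?thesis by simp
qed

lemma dual_basis_retract:
  assumes "left_module R F" "left_module R P" "dual_basis R F I b c"
    and "u \<in> module_hom R P F" "v \<in> module_hom R F P" "\<And>x. x \<in> carrier P \<Longrightarrow> v (u x) = x"
  shows "dual_basis R P I (\<lambda>i. v (b i)) (\<lambda>i x. c i (u x))"
  unfolding dual_basis_def
proof (intro conjI ballI)
  interpret F: left_module R F by fact
  interpret P: left_module R P by fact
  note D = dual_basisD[OF assms(3)]
  show "(\<lambda>i. v (b i)) \<in> I \<rightarrow> carrier P"
    using D(1) module_hom_closed[OF assms(5)] by auto
  show "(\<lambda>x. c i (u x)) \<in> module_hom R P (regular_module R)" if "i \<in> I" for i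
    using assms(4) D(2)[OF that] by (rule module_hom_comp)
  fix x assume x: "x \<in> carrier P"
  then have ux: "u x \<in> carrier F" using module_hom_closed[OF assms(4)] by simp
  show "finite {i \<in> I. c i (u x) \<noteq> \<zero>\<^bsub>R\<^esub>}" using D(4)[OF ux] .
  have "finsum P (\<lambda>i. c i (u x) \<odot>\<^bsub>P\<^esub> v (b i)) {i \<in> I. c i (u x) \<noteq> \<zero>\<^bsub>R\<^esub>} =
      finsum P (\<lambda>i. v (c i (u x) \<odot>\<^bsub>F\<^esub> b i)) {i \<in> I. c i (u x) \<noteq> \<zero>\<^bsub>R\<^esub>}"
    using D(1,3) ux module_hom_smult[OF assms(5)] module_hom_closed[OF assms(5)]
    by (intro P.M.finsum_cong') auto
  also have "\<dots> = v (finsum F (\<lambda>i. c i (u x) \<odot>\<^bsub>F\<^esub> b i) {i \<in> I. c i (u x) \<noteq> \<zero>\<^bsub>R\<^esub>})"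
    using D(1,3) ux by (intro module_hom_finsum[OF assms(1,2,5), symmetric]) auto
  also have "\<dots> = x"
    unfolding D(5)[OF ux] by (rule assms(6)[OF x])
  finally show "finsum P (\<lambda>i. c i (u x) \<odot>\<^bsub>P\<^esub> v (b i)) {i \<in> I. c i (u x) \<noteq> \<zero>\<^bsub>R\<^esub>} = x" .
qed

lemma dual_basis_free_module:
  assumes "ring R"
  shows "dual_basis R (free_module R I) I (\<lambda>i. \<lambda>j\<in>I. if j = i then \<one>\<^bsub>R\<^esub> else \<zero>\<^bsub>R\<^esub>) (\<lambda>i f. f i)"
  unfolding dual_basis_def
proof (intro conjI ballI)
  interpret ring R by fact
  let ?F = "free_module R I" and ?e = "\<lambda>i. \<lambda>j\<in>I. if j = i then \<one>\<^bsub>R\<^esub> else \<zero>\<^bsub>R\<^esub>"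
  interpret F: left_module R ?F using assms by (rule left_module_free_module)
  have e: "?e i \<in> carrier ?F" if "i \<in> I" for i
    by (auto simp: free_module_simps intro: finite_subset[of _ "{i}"])
  then show "?e \<in> I \<rightarrow> carrier ?F" by auto
  show coord: "(\<lambda>f. f i) \<in> module_hom R ?F (regular_module R)" if "i \<in> I" for i
    using that by (auto simp: module_hom_def free_module_simps)
  fix f assume f: "f \<in> carrier ?F"
  show fin: "finite {i \<in> I. f i \<noteq> \<zero>\<^bsub>R\<^esub>}" using f by (simp add: free_module_simps)
  let ?A = "{i \<in> I. f i \<noteq> \<zero>\<^bsub>R\<^esub>}"
  let ?s = "finsum ?F (\<lambda>i. f i \<odot>\<^bsub>?F\<^esub> ?e i) ?A"
  have fR: "f i \<in> carrier R" if "i \<in> I" for i using f that by (auto simp: free_module_simps)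
  have fe: "(\<lambda>i. f i \<odot>\<^bsub>?F\<^esub> ?e i) \<in> ?A \<rightarrow> carrier ?F" using fR e by auto
  have s: "?s \<in> carrier ?F" using fe by (rule F.M.finsum_closed)
  have "?s j = f j" if j: "j \<in> I" for j
  proof -
    have "?s j = finsum R (\<lambda>i. (f i \<odot>\<^bsub>?F\<^esub> ?e i) j) ?A"
      using module_hom_finsum[OF F.left_module_axioms left_module_regular[OF assms] coord[OF j] fe]
      by simp
    also have "\<dots> = finsum R (\<lambda>i. if j = i then f i else \<zero>\<^bsub>R\<^esub>) ?A"
      using j fR by (intro finsum_cong') (auto simp: free_module_simps)
    also have "\<dots> = f j"
    proof (cases "j \<in> ?A")
      case True
      then show ?thesis using fin fR by (intro finsum_singleton) auto
    next
      case False
      then have "finsum R (\<lambda>i. if j = i then f i else \<zero>\<^bsub>R\<^esub>) ?A = finsum R (\<lambda>i. \<zero>\<^bsub>R\<^esub>) ?A"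
        by (intro finsum_cong') auto
      then show ?thesis using False j by simp
    qed
    finally show ?thesis .
  qed
  then show "?s = f"
    using f s by (intro extensionalityI[of _ I]) (auto simp: free_module_simps PiE_iff)
qed

text \<open>
  A direct summand of a free module inherits a dual basis from the standard basis, by projecting
  the basis elements and restricting the coordinates.
\<close>

lemma projective_module_dual_basis:
  fixes P :: "('a, 'b, 'm) module_scheme"
  assumes "projective_module R P"
  obtains I :: "'b set" and b c where "dual_basis R P I b c"
proof -
  have P: "left_module R P" using assms by (simp add: projective_module_def)
  obtain I :: "'b set" and H K h where dd: "direct_decomposition R (free_module R I) H K"
    and h: "h \<in> module_hom R P ((free_module R I)\<lparr>carrier := H\<rparr>)" "bij_betw h (carrier P) H"
    using assms by (auto simp: projective_module_def module_isomorphic_def)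
  let ?F = "free_module R I"
  have F: "left_module R ?F" using ring_of_left_module[OF P] by (rule left_module_free_module)
  obtain p where p: "p \<in> module_hom R ?F ?F" "\<And>x. x \<in> carrier ?F \<Longrightarrow> p x \<in> H"
    "\<And>x. x \<in> H \<Longrightarrow> p x = x"
    using decomposition_projection[OF F dd] by blast
  have HF: "H \<subseteq> carrier ?F" using dd submoduleD(1) by (auto simp: direct_decomposition_def)
  have u: "h \<in> module_hom R P ?F"
    using h(1) HF by (auto simp: module_hom_def)
  have v: "(\<lambda>f. inv_into (carrier P) h (p f)) \<in> module_hom R ?F P"
  proof (rule module_hom_comp[where h = p and k = "inv_into (carrier P) h"])
    show "p \<in> module_hom R ?F (?F\<lparr>carrier := H\<rparr>)"
      using p by (auto simp: module_hom_def)
    show "inv_into (carrier P) h \<in> module_hom R (?F\<lparr>carrier := H\<rparr>) P"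
      using h by (intro module_hom_inverse[OF P]) simp_all
  qed
  have vu: "inv_into (carrier P) h (p (h x)) = x" if "x \<in> carrier P" for x
    using that h p(3) by (auto simp: bij_betw_def)
  show thesis
    by (rule that, rule dual_basis_retract[OF F P _ u, OF _ v])
      (use vu dual_basis_free_module[OF ring_of_left_module[OF P]] in auto)
qed

text \<open>
  The lifting property of projective modules: choose preimages of the \<open>h (b i)\<close> and combine them
  with the coordinates. The sum runs over the support of \<open>x\<close>, which changes with \<open>x\<close>; for
  additivity it is enlarged to a finite set that contains all supports involved.
\<close>

lemma dual_basis_lift:
  assumes "left_module R P" "left_module R X" "left_module R Y" "dual_basis R P I b c"
    and "h \<in> module_hom R P Y" "k \<in> module_hom R X Y" "h ` carrier P \<subseteq> k ` carrier X"
  obtains l where "l \<in> module_hom R P X" "\<And>x. x \<in> carrier P \<Longrightarrow> k (l x) = h x"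
proof -
  interpret P: left_module R P by fact
  interpret X: left_module R X by fact
  interpret Y: left_module R Y by fact
  note D = dual_basisD[OF assms(4)]
  have "\<forall>i\<in>I. \<exists>y\<in>carrier X. k y = h (b i)"
  proof
    fix i assume "i \<in> I"
    then have "h (b i) \<in> k ` carrier X" using assms(7) D(1) by auto
    then show "\<exists>y\<in>carrier X. k y = h (b i)" by auto
  qed
  then obtain y where y: "\<And>i. i \<in> I \<Longrightarrow> y i \<in> carrier X" "\<And>i. i \<in> I \<Longrightarrow> k (y i) = h (b i)"
    by metis
  define supp where "supp x = {i \<in> I. c i x \<noteq> \<zero>\<^bsub>R\<^esub>}" for x
  define l where "l x = finsum X (\<lambda>i. c i x \<odot>\<^bsub>X\<^esub> y i) (supp x)" for x
  have l_eq: "l x = finsum X (\<lambda>i. c i x \<odot>\<^bsub>X\<^esub> y i) A"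
    if "x \<in> carrier P" "finite A" "supp x \<subseteq> A" "A \<subseteq> I" for x A
    using that y(1) D(3) unfolding l_def supp_def by (intro finsum_over_support[OF assms(2)]) auto
  have fin: "finite (supp x)" "supp x \<subseteq> I" if "x \<in> carrier P" for x
    using D(4) that by (auto simp: supp_def)
  have partial: "(\<lambda>x. finsum X (\<lambda>i. c i x \<odot>\<^bsub>X\<^esub> y i) A) \<in> module_hom R P X" if "A \<subseteq> I" for A
  proof (rule module_hom_sum[OF assms(1,2)])
    fix i assume "i \<in> A"
    with that have i: "i \<in> I" by auto
    show "(\<lambda>x. c i x \<odot>\<^bsub>X\<^esub> y i) \<in> module_hom R P X"
      using y(1)[OF i] D(2,3)[OF i]
      by (intro module_homI)
        (auto simp: module_hom_add module_hom_smult X.smult_l_distr X.smult_assoc1)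
  qed
  have "l \<in> module_hom R P X"
  proof (rule module_homI)
    show "l x \<in> carrier X" if "x \<in> carrier P" for x
      using module_hom_closed[OF partial[OF fin(2)[OF that]] that] by (simp add: l_def)
    fix x x' assume x: "x \<in> carrier P" "x' \<in> carrier P"
    let ?A = "supp x \<union> supp x' \<union> supp (x \<oplus>\<^bsub>P\<^esub> x')"
    have A: "finite ?A" "?A \<subseteq> I" using fin x by auto
    then have "l z = finsum X (\<lambda>i. c i z \<odot>\<^bsub>X\<^esub> y i) ?A" if "z \<in> {x, x', x \<oplus>\<^bsub>P\<^esub> x'}" for z
      using that x by (intro l_eq) auto
    then show "l (x \<oplus>\<^bsub>P\<^esub> x') = l x \<oplus>\<^bsub>X\<^esub> l x'"
      using module_hom_add[OF partial[OF A(2)] x] by simp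
  next
    fix r x assume x: "r \<in> carrier R" "x \<in> carrier P"
    let ?A = "supp x \<union> supp (r \<odot>\<^bsub>P\<^esub> x)"
    have A: "finite ?A" "?A \<subseteq> I" using fin x by auto
    then have "l z = finsum X (\<lambda>i. c i z \<odot>\<^bsub>X\<^esub> y i) ?A" if "z \<in> {x, r \<odot>\<^bsub>P\<^esub> x}" for z
      using that x by (intro l_eq) auto
    then show "l (r \<odot>\<^bsub>P\<^esub> x) = r \<odot>\<^bsub>X\<^esub> l x"
      using module_hom_smult[OF partial[OF A(2)] x] by simp
  qed
  moreover have "k (l x) = h x" if x: "x \<in> carrier P" for x
  proof -
    have s: "i \<in> I" if "i \<in> supp x" for i using that by (simp add: supp_def)
    have "k (l x) = finsum Y (\<lambda>i. k (c i x \<odot>\<^bsub>X\<^esub> y i)) (supp x)"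
      unfolding l_def using x y D(3) s by (intro module_hom_finsum[OF assms(2,3,6)]) auto
    also have "\<dots> = finsum Y (\<lambda>i. h (c i x \<odot>\<^bsub>P\<^esub> b i)) (supp x)"
      using x y D(1,3) s module_hom_smult[OF assms(5)] module_hom_smult[OF assms(6)]
        module_hom_closed[OF assms(5)]
      by (intro Y.M.finsum_cong') auto
    also have "\<dots> = h (finsum P (\<lambda>i. c i x \<odot>\<^bsub>P\<^esub> b i) (supp x))"
      using x D(1,3) s by (intro module_hom_finsum[OF assms(1,3,5), symmetric]) auto
    also have "\<dots> = h x" using D(5)[OF x] by (simp add: supp_def)
    finally show ?thesis .
  qed
  ultimately show thesis by (rule that)
qed

text \<open>
  The elements whose support lies in the union \<open>J\<close> of the supports of the generators form a
  submodule that contains the generators, hence everything.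
\<close>

lemma finitely_generated_finite_dual_basis:
  assumes "left_module R P" "dual_basis R P I b c" "finitely_generated R P"
  obtains J where "finite J" "dual_basis R P J b c"
proof -
  interpret P: left_module R P by fact
  note D = dual_basisD[OF assms(2)]
  obtain A where A: "finite A" "A \<subseteq> carrier P"
    "\<And>H. submodule H R P \<Longrightarrow> A \<subseteq> H \<Longrightarrow> H = carrier P"
    using assms(3) by (auto simp: finitely_generated_def)
  define J where "J = (\<Union>a\<in>A. {i \<in> I. c i a \<noteq> \<zero>\<^bsub>R\<^esub>})"
  have J: "finite J" "J \<subseteq> I" using A(1,2) D(4) by (auto simp: J_def)
  let ?H = "{x \<in> carrier P. \<forall>i\<in>I - J. c i x = \<zero>\<^bsub>R\<^esub>}"
  have z: "c i \<zero>\<^bsub>P\<^esub> = \<zero>\<^bsub>R\<^esub>" if "i \<in> I" for i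
    using module_hom_zero[OF assms(1) left_module_regular[OF P.R.ring_axioms] D(2)[OF that]] by simp
  have "submodule ?H R P"
    by (rule submoduleI[OF assms(1)])
      (auto simp: z module_hom_add[OF D(2)] module_hom_smult[OF D(2)])
  then have H: "?H = carrier P" using A(2) by (intro A(3)) (auto simp: J_def)
  have "dual_basis R P J b c"
  proof (rule finite_dual_basisI[OF assms(1) J(1)])
    fix x assume x: "x \<in> carrier P"
    then have "{i \<in> I. c i x \<noteq> \<zero>\<^bsub>R\<^esub>} \<subseteq> J" using H by blast
    then have "finsum P (\<lambda>i. c i x \<odot>\<^bsub>P\<^esub> b i) {i \<in> I. c i x \<noteq> \<zero>\<^bsub>R\<^esub>} =
        finsum P (\<lambda>i. c i x \<odot>\<^bsub>P\<^esub> b i) J"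
      using x J D(1,3) by (intro finsum_over_support[OF assms(1)]) auto
    then show "finsum P (\<lambda>i. c i x \<odot>\<^bsub>P\<^esub> b i) J = x"
      unfolding D(5)[OF x] by (rule sym)
  qed (use J D(1,2) in auto)
  with J(1) show thesis by (rule that)
qed

lemma finite_dual_basis_generates:
  assumes "left_module R P" "dual_basis R P I b c" "finite I"
    and "submodule H R P" "b ` I \<subseteq> H"
  shows "H = carrier P"
proof
  note D = dual_basisD[OF assms(2)]
  show "carrier P \<subseteq> H"
  proof
    fix x assume x: "x \<in> carrier P"
    have "finsum P (\<lambda>i. c i x \<odot>\<^bsub>P\<^esub> b i) I \<in> H"
      using assms(5) D(3) x submoduleD(4)[OF assms(4)]
      by (intro submodule_finsum[OF assms(1,4)]) auto
    then show "x \<in> H" unfolding dual_basis_finite_sum[OF assms(1-3) x] .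
  qed
qed (rule submoduleD(1)[OF assms(4)])

lemma finite_dual_basis_finitely_generated:
  assumes "left_module R P" "dual_basis R P I b c" "finite I"
  shows "finitely_generated R P"
  unfolding finitely_generated_def
  using finite_dual_basis_generates[OF assms] assms(3) dual_basisD(1)[OF assms(2)]
  by (intro exI[of _ "b ` I"]) auto

text \<open>
  The index set has to be moved into the element type of \<open>P\<close>, as \<open>projective_module\<close> demands,
  and \<open>b\<close> need not be injective. So the free module on the set of values of \<open>b\<close> is taken; it maps
  onto \<open>P\<close>, and the lifting property of \<open>P\<close> splits this map.
\<close>

lemma finite_dual_basis_projective:
  fixes P :: "('a, 'b, 'm) module_scheme"
  assumes "left_module R P" "dual_basis R P I b c" "finite I"
  shows "projective_module R P"
proof -
  interpret P: left_module R P by fact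
  note D = dual_basisD[OF assms(2)]
  let ?J = "b ` I"
  let ?F = "free_module R ?J"
  let ?e = "\<lambda>y. \<lambda>z\<in>?J. if z = y then \<one>\<^bsub>R\<^esub> else \<zero>\<^bsub>R\<^esub>"
  have F: "left_module R ?F" by (rule left_module_free_module) (rule P.R.ring_axioms)
  interpret F: left_module R ?F by (rule F)
  note DF = dual_basisD[OF dual_basis_free_module[OF P.R.ring_axioms, of ?J]]
  define v where "v f = finsum P (\<lambda>y. f y \<odot>\<^bsub>P\<^esub> y) ?J" for f
  have J: "?J \<subseteq> carrier P" "finite ?J" using D(1) assms(3) by auto
  have v: "v \<in> module_hom R ?F P"
    unfolding v_def
  proof (rule module_hom_sum[OF F assms(1)])
    fix y assume y: "y \<in> ?J"
    then have "y \<in> carrier P" using J by auto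
    then show "(\<lambda>f. f y \<odot>\<^bsub>P\<^esub> y) \<in> module_hom R ?F P"
      using module_hom_add[OF DF(2)[OF y]] module_hom_smult[OF DF(2)[OF y]] DF(3)[OF y]
      by (intro module_homI) (simp_all add: P.smult_l_distr P.smult_assoc1)
  qed
  have "v (?e y) = y" if y: "y \<in> ?J" for y
  proof -
    have "v (?e y) = finsum P (\<lambda>z. if y = z then z else \<zero>\<^bsub>P\<^esub>) ?J"
      unfolding v_def using J y by (intro P.M.finsum_cong') auto
    also have "\<dots> = y" using J y by (intro P.M.finsum_singleton) auto
    finally show ?thesis .
  qed
  then have "?J \<subseteq> v ` carrier ?F"
    using DF(1) by (metis (no_types, lifting) image_eqI subsetI)
  then have gen: "carrier P \<subseteq> v ` carrier ?F"
    using finite_dual_basis_generates[OF assms submodule_image[OF F assms(1) v]] by simp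
  obtain u where u: "u \<in> module_hom R P ?F" "\<And>x. x \<in> carrier P \<Longrightarrow> v (u x) = x"
    using dual_basis_lift[OF assms(1) F assms(1,2) module_hom_id v] gen by (metis image_ident)
  let ?w = "\<lambda>f. u (v f)"
  have dd: "direct_decomposition R ?F (?w ` carrier ?F) (a_kernel ?F ?F ?w)"
    using module_hom_comp[OF v u(1)] module_hom_closed[OF v] u(2)
    by (intro idempotent_decomposition[OF F]) auto
  have im: "?w ` carrier ?F = u ` carrier P"
    using gen module_hom_closed[OF v] by (auto simp: image_iff)
  have "u \<in> module_hom R P (?F\<lparr>carrier := ?w ` carrier ?F\<rparr>)"
    unfolding im using u(1) by (auto simp: module_hom_def)
  moreover have "bij_betw u (carrier P) (carrier (?F\<lparr>carrier := ?w ` carrier ?F\<rparr>))"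
    using u(2) by (auto simp: im bij_betw_def intro: inj_on_inverseI)
  ultimately show ?thesis
    using assms(1) dd unfolding projective_module_def module_isomorphic_def by blast
qed

section \<open>Duals and biduals\<close>

lemma dual_module_simps:
  "carrier (dual_module R X) = module_hom R X (regular_module R) \<inter> extensional (carrier X)"
  "\<zero>\<^bsub>dual_module R X\<^esub> = (\<lambda>x\<in>carrier X. \<zero>\<^bsub>R\<^esub>)"
  "\<phi> \<oplus>\<^bsub>dual_module R X\<^esub> \<psi> = (\<lambda>x\<in>carrier X. \<phi> x \<oplus>\<^bsub>R\<^esub> \<psi> x)"
  "r \<odot>\<^bsub>dual_module R X\<^esub> \<phi> = (\<lambda>x\<in>carrier X. \<phi> x \<otimes>\<^bsub>R\<^esub> r)"
  by (simp_all add: dual_module_def)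

lemma dual_functional: "\<phi> \<in> carrier (dual_module R X) \<Longrightarrow> \<phi> \<in> module_hom R X (regular_module R)"
  by (simp add: dual_module_simps)

lemma dual_functional_closed:
  "\<phi> \<in> carrier (dual_module R X) \<Longrightarrow> x \<in> carrier X \<Longrightarrow> \<phi> x \<in> carrier R"
  using module_hom_closed[OF dual_functional] by fastforce

lemma restrict_functional_in_dual:
  assumes "left_module R X" "h \<in> module_hom R X (regular_module R)"
  shows "restrict h (carrier X) \<in> carrier (dual_module R X)"
  using module_hom_cong[OF assms, of "restrict h (carrier X)"] by (simp add: dual_module_simps)

lemma dual_eqI:
  assumes "\<phi> \<in> carrier (dual_module R X)" "\<psi> \<in> carrier (dual_module R X)"
    and "\<And>x. x \<in> carrier X \<Longrightarrow> \<phi> x = \<psi> x"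
  shows "\<phi> = \<psi>"
  using assms by (intro extensionalityI[of _ "carrier X"]) (auto simp: dual_module_simps)

lemma finsum_op_ring [simp]: "finsum (op_ring R) = finsum R"
  by (intro ext) (simp add: finsum_def finprod_def op_ring_def)

lemma evaluation_functional:
  assumes "x \<in> carrier X"
  shows "(\<lambda>\<phi>. \<phi> x) \<in> module_hom (op_ring R) (dual_module R X) (regular_module (op_ring R))"
  using assms by (intro module_homI) (auto simp: dual_functional_closed, auto simp: dual_module_simps)

lemma dual_finsum_apply:
  assumes "left_module R X" "\<Phi> \<in> A \<rightarrow> carrier (dual_module R X)" "x \<in> carrier X"
  shows "finsum (dual_module R X) \<Phi> A x = finsum R (\<lambda>i. \<Phi> i x) A"
  using module_hom_finsum[OF left_module_dual_module[OF assms(1)]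
      left_module_regular[OF ring_op_ring[OF ring_of_left_module[OF assms(1)]]]
      evaluation_functional[OF assms(3)] assms(2)]
  by simp

definition evaluation ::
  "('a, 'r) ring_scheme \<Rightarrow> ('a, 'b, 'm) module_scheme \<Rightarrow> 'b \<Rightarrow> ('b \<Rightarrow> 'a) \<Rightarrow> 'a"
  where "evaluation R X x = (\<lambda>\<phi>\<in>carrier (dual_module R X). \<phi> x)"

abbreviation bidual ::
  "('a, 'r) ring_scheme \<Rightarrow> ('a, 'b, 'm) module_scheme \<Rightarrow> ('a, ('b \<Rightarrow> 'a) \<Rightarrow> 'a) module"
  where "bidual R X \<equiv> dual_module (op_ring R) (dual_module R X)"

lemma left_module_bidual: "left_module R X \<Longrightarrow> left_module R (bidual R X)"
  using left_module_dual_module[OF left_module_dual_module, of R X] by simp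

lemma evaluation_hom:
  assumes "left_module R X"
  shows "evaluation R X \<in> module_hom R X (bidual R X)"
proof -
  interpret left_module R X by fact
  have closed: "evaluation R X x \<in> carrier (bidual R X)" if "x \<in> carrier X" for x
    unfolding evaluation_def
    by (rule restrict_functional_in_dual[OF left_module_dual_module[OF assms]
          evaluation_functional[OF that]])
  show ?thesis
  proof (rule module_homI)
    fix x y assume xy: "x \<in> carrier X" "y \<in> carrier X"
    have "\<phi> (x \<oplus>\<^bsub>X\<^esub> y) = \<phi> x \<oplus>\<^bsub>R\<^esub> \<phi> y" if "\<phi> \<in> carrier (dual_module R X)" for \<phi>
      using module_hom_add[OF dual_functional[OF that] xy] by simp
    then show "evaluation R X (x \<oplus>\<^bsub>X\<^esub> y) = evaluation R X x \<oplus>\<^bsub>bidual R X\<^esub> evaluation R X y"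
      by (auto simp: evaluation_def dual_module_simps(3) intro!: restrict_ext)
  next
    fix r x assume rx: "r \<in> carrier R" "x \<in> carrier X"
    have "\<phi> (r \<odot>\<^bsub>X\<^esub> x) = r \<otimes>\<^bsub>R\<^esub> \<phi> x" if "\<phi> \<in> carrier (dual_module R X)" for \<phi>
      using module_hom_smult[OF dual_functional[OF that] rx] by simp
    then show "evaluation R X (r \<odot>\<^bsub>X\<^esub> x) = r \<odot>\<^bsub>bidual R X\<^esub> evaluation R X x"
      by (auto simp: evaluation_def dual_module_simps(4) intro!: restrict_ext)
  qed (rule closed)
qed

text \<open>
  Finitely many elements \<open>x\<^sub>i\<close> and functionals \<open>\<phi>\<^sub>i\<close> such that no functional can tell \<open>m\<close> from
  \<open>\<Sum> \<phi>\<^sub>i(m) x\<^sub>i\<close>. For projective \<open>M\<close> a finite dual basis has this property; in general the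
  condition sees only the image of \<open>M\<close> in its bidual.
\<close>

definition evaluation_basis ::
  "('a, 'r) ring_scheme \<Rightarrow> ('a, 'b, 'm) module_scheme \<Rightarrow> 'i set \<Rightarrow> ('i \<Rightarrow> 'b) \<Rightarrow> ('i \<Rightarrow> 'b \<Rightarrow> 'a) \<Rightarrow> bool"
  where "evaluation_basis R M I x \<phi> \<longleftrightarrow>
    finite I \<and> x \<in> I \<rightarrow> carrier M \<and> \<phi> \<in> I \<rightarrow> carrier (dual_module R M) \<and>
    (\<forall>\<psi>\<in>carrier (dual_module R M). \<forall>m\<in>carrier M.
      \<psi> (finsum M (\<lambda>i. \<phi> i m \<odot>\<^bsub>M\<^esub> x i) I) = \<psi> m)"

lemma evaluation_basisD:
  assumes "evaluation_basis R M I x \<phi>"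
  shows "finite I" "\<And>i. i \<in> I \<Longrightarrow> x i \<in> carrier M"
    "\<And>i. i \<in> I \<Longrightarrow> \<phi> i \<in> carrier (dual_module R M)"
    "\<And>i m. i \<in> I \<Longrightarrow> m \<in> carrier M \<Longrightarrow> \<phi> i m \<in> carrier R"
    "\<And>\<psi> m. \<psi> \<in> carrier (dual_module R M) \<Longrightarrow> m \<in> carrier M \<Longrightarrow>
      \<psi> (finsum M (\<lambda>i. \<phi> i m \<odot>\<^bsub>M\<^esub> x i) I) = \<psi> m"
proof -
  show \<phi>: "\<phi> i \<in> carrier (dual_module R M)" if "i \<in> I" for i
    using assms that by (auto simp: evaluation_basis_def)
  show "\<phi> i m \<in> carrier R" if "i \<in> I" "m \<in> carrier M" for i m
    using dual_functional_closed[OF \<phi>[OF that(1)] that(2)] .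
qed (use assms in \<open>auto simp: evaluation_basis_def\<close>)

lemma functional_linear_combination:
  assumes "left_module R M" "\<psi> \<in> carrier (dual_module R M)"
    "\<And>i. i \<in> I \<Longrightarrow> a i \<in> carrier R" "\<And>i. i \<in> I \<Longrightarrow> x i \<in> carrier M"
  shows "\<psi> (finsum M (\<lambda>i. a i \<odot>\<^bsub>M\<^esub> x i) I) = finsum R (\<lambda>i. a i \<otimes>\<^bsub>R\<^esub> \<psi> (x i)) I"
proof -
  interpret left_module R M by fact
  have "\<psi> (finsum M (\<lambda>i. a i \<odot>\<^bsub>M\<^esub> x i) I) = finsum R (\<lambda>i. \<psi> (a i \<odot>\<^bsub>M\<^esub> x i)) I"
    using module_hom_finsum[OF assms(1) left_module_regular[OF R.ring_axioms] dual_functional[OF assms(2)],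
        of "\<lambda>i. a i \<odot>\<^bsub>M\<^esub> x i" I] assms(3,4) by auto
  also have "\<dots> = finsum R (\<lambda>i. a i \<otimes>\<^bsub>R\<^esub> \<psi> (x i)) I"
    using assms(3,4) module_hom_smult[OF dual_functional[OF assms(2)]]
      dual_functional_closed[OF assms(2)]
    by (intro R.finsum_cong') auto
  finally show ?thesis .
qed

lemma finite_dual_basis_evaluation_basis:
  assumes "left_module R P" "dual_basis R P I b c" "finite I"
  shows "evaluation_basis R P I b (\<lambda>i. restrict (c i) (carrier P))"
  unfolding evaluation_basis_def
proof (intro conjI ballI)
  note D = dual_basisD[OF assms(2)]
  show "(\<lambda>i. restrict (c i) (carrier P)) \<in> I \<rightarrow> carrier (dual_module R P)"
    using restrict_functional_in_dual[OF assms(1) D(2)] by auto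
  fix \<psi> m assume "m \<in> carrier P"
  then show "\<psi> (finsum P (\<lambda>i. restrict (c i) (carrier P) m \<odot>\<^bsub>P\<^esub> b i) I) = \<psi> m"
    using dual_basis_finite_sum[OF assms, of m] by simp
qed (use assms(3) dual_basisD(1)[OF assms(2)] in auto)

text \<open>
  Reading \<open>\<psi> m = \<Sum> \<phi>\<^sub>i(m) \<psi>(x\<^sub>i)\<close> as an equation between functionals of \<open>m\<close> shows that the
  \<open>\<phi>\<^sub>i\<close> form a dual basis of \<open>M*\<close> whose coordinates are the evaluations at the \<open>x\<^sub>i\<close>.
\<close>

lemma dual_basis_of_dual:
  assumes "left_module R M" "evaluation_basis R M I x \<phi>"
  shows "dual_basis (op_ring R) (dual_module R M) I \<phi> (\<lambda>i \<psi>. \<psi> (x i))"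
proof (rule finite_dual_basisI)
  interpret left_module R M by fact
  note E = evaluation_basisD[OF assms(2)]
  let ?D = "dual_module R M"
  show D: "left_module (op_ring R) ?D" by (rule left_module_dual_module[OF assms(1)])
  interpret D: left_module "op_ring R" ?D by (rule D)
  fix \<psi> assume \<psi>: "\<psi> \<in> carrier ?D"
  have c: "(\<lambda>i. \<psi> (x i) \<odot>\<^bsub>?D\<^esub> \<phi> i) \<in> I \<rightarrow> carrier ?D"
    using E(2,3) dual_functional_closed[OF \<psi>] by auto
  show "finsum ?D (\<lambda>i. \<psi> (x i) \<odot>\<^bsub>?D\<^esub> \<phi> i) I = \<psi>"
  proof (rule dual_eqI[OF _ \<psi>])
    show "finsum ?D (\<lambda>i. \<psi> (x i) \<odot>\<^bsub>?D\<^esub> \<phi> i) I \<in> carrier ?D"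
      using c by (rule D.M.finsum_closed)
    fix m assume m: "m \<in> carrier M"
    have "finsum ?D (\<lambda>i. \<psi> (x i) \<odot>\<^bsub>?D\<^esub> \<phi> i) I m = finsum R (\<lambda>i. (\<psi> (x i) \<odot>\<^bsub>?D\<^esub> \<phi> i) m) I"
      by (rule dual_finsum_apply[OF assms(1) c m])
    also have "\<dots> = finsum R (\<lambda>i. \<phi> i m \<otimes>\<^bsub>R\<^esub> \<psi> (x i)) I"
      using m by (simp add: dual_module_simps)
    also have "\<dots> = \<psi> (finsum M (\<lambda>i. \<phi> i m \<odot>\<^bsub>M\<^esub> x i) I)"
      using E(2,4) m by (intro functional_linear_combination[OF assms(1) \<psi>, symmetric])
    also have "\<dots> = \<psi> m" by (rule E(5)[OF \<psi> m])
    finally show "finsum ?D (\<lambda>i. \<psi> (x i) \<odot>\<^bsub>?D\<^esub> \<phi> i) I m = \<psi> m" .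
  qed
qed (use evaluation_basisD[OF assms(2)] in \<open>auto intro: evaluation_functional\<close>)

text \<open>
  A functional \<open>\<alpha>\<close> on the dual is evaluation at \<open>\<Sum> \<alpha>(\<phi>\<^sub>i) x\<^sub>i\<close>.
\<close>

lemma evaluation_surjective:
  assumes "left_module R M" "evaluation_basis R M I x \<phi>"
  shows "evaluation R M ` carrier M = carrier (bidual R M)"
proof (intro equalityI subsetI)
  interpret left_module R M by fact
  note E = evaluation_basisD[OF assms(2)]
  let ?D = "dual_module R M"
  have D: "left_module (op_ring R) ?D" by (rule left_module_dual_module[OF assms(1)])
  fix \<alpha> assume \<alpha>: "\<alpha> \<in> carrier (bidual R M)"
  have a: "\<alpha> (\<phi> i) \<in> carrier R" if "i \<in> I" for i
    using dual_functional_closed[OF \<alpha> E(3)[OF that]] by simp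
  define m where "m = finsum M (\<lambda>i. \<alpha> (\<phi> i) \<odot>\<^bsub>M\<^esub> x i) I"
  have m: "m \<in> carrier M" unfolding m_def using a E(2) by (intro M.finsum_closed) auto
  have "evaluation R M m = \<alpha>"
  proof (rule dual_eqI[OF module_hom_closed[OF evaluation_hom[OF assms(1)] m] \<alpha>])
    fix \<psi> assume \<psi>: "\<psi> \<in> carrier ?D"
    have "evaluation R M m \<psi> = finsum R (\<lambda>i. \<alpha> (\<phi> i) \<otimes>\<^bsub>R\<^esub> \<psi> (x i)) I"
      unfolding evaluation_def m_def
      using \<psi> functional_linear_combination[OF assms(1) \<psi>, of I "\<lambda>i. \<alpha> (\<phi> i)" x] a E(2) by simp
    also have "\<dots> = \<alpha> (finsum ?D (\<lambda>i. \<psi> (x i) \<odot>\<^bsub>?D\<^esub> \<phi> i) I)"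
      using functional_linear_combination[OF D \<alpha>, of I "\<lambda>i. \<psi> (x i)" \<phi>]
        dual_functional_closed[OF \<psi>] E(2,3) by simp
    also have "\<dots> = \<alpha> \<psi>"
      unfolding dual_basis_finite_sum[OF D dual_basis_of_dual[OF assms] E(1) \<psi>] ..
    finally show "evaluation R M m \<psi> = \<alpha> \<psi>" .
  qed
  with m show "\<alpha> \<in> evaluation R M ` carrier M" by blast
qed (use module_hom_closed[OF evaluation_hom[OF assms(1)]] in auto)

lemma evaluation_bijective:
  assumes "left_module R P" "dual_basis R P I b c" "finite I"
  shows "bij_betw (evaluation R P) (carrier P) (carrier (bidual R P))"
proof -
  have "inj_on (evaluation R P) (carrier P)"
  proof (rule module_hom_inj_onI[OF assms(1) left_module_bidual evaluation_hom])
    fix x assume x: "x \<in> carrier P" "evaluation R P x = \<zero>\<^bsub>bidual R P\<^esub>"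
    show "x = \<zero>\<^bsub>P\<^esub>"
    proof (rule dual_basis_separates[OF assms(1,2) x(1)])
      fix i assume "i \<in> I"
      then have "restrict (c i) (carrier P) \<in> carrier (dual_module R P)"
        by (intro restrict_functional_in_dual[OF assms(1)] dual_basisD(2)[OF assms(2)])
      with fun_cong[OF x(2), of "restrict (c i) (carrier P)"] x(1) show "c i x = \<zero>\<^bsub>R\<^esub>"
        by (simp add: evaluation_def dual_module_simps(2))
    qed
  qed (rule assms(1))+
  then show ?thesis
    using evaluation_surjective[OF assms(1) finite_dual_basis_evaluation_basis[OF assms]]
    by (simp add: bij_betw_def)
qed

section \<open>Splitting off the elements killed by all functionals\<close>

text \<open>
  The intersection of the kernels of all homomorphisms to \<open>R\<close>, called the reject of \<open>R\<close> in \<open>M\<close>.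
\<close>

definition reject :: "('a, 'r) ring_scheme \<Rightarrow> ('a, 'b, 'm) module_scheme \<Rightarrow> 'b set"
  where "reject R M = {m \<in> carrier M. \<forall>\<psi>\<in>carrier (dual_module R M). \<psi> m = \<zero>\<^bsub>R\<^esub>}"

lemma direct_decomposition_commute:
  assumes "left_module R X" "direct_decomposition R X H K"
  shows "direct_decomposition R X K H"
proof -
  interpret left_module R X by fact
  have "submodule H R X" "submodule K R X"
    using assms(2) by (simp_all add: direct_decomposition_def)
  then have "k \<oplus>\<^bsub>X\<^esub> h = h \<oplus>\<^bsub>X\<^esub> k" if "h \<in> H" "k \<in> K" for h k
    using that submoduleD(1) by (intro M.a_comm) blast+
  then have "K <+>\<^bsub>X\<^esub> H = H <+>\<^bsub>X\<^esub> K"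
    unfolding set_add_def' by (subst SUP_commute) (intro SUP_cong refl, simp)
  with assms(2) show ?thesis by (auto simp: direct_decomposition_def)
qed

text \<open>
  A functional on a direct summand \<open>H\<close> of a direct summand \<open>reject R M\<close> of \<open>M\<close> extends to \<open>M\<close>
  along the projections, so it vanishes on \<open>H\<close>; on a projective module functionals separate
  elements.
\<close>

lemma stable_reject:
  fixes M :: "('a, 'b, 'm) module_scheme"
  assumes "left_module R M" "direct_decomposition R M P (reject R M)"
  shows "stable_module R (M\<lparr>carrier := reject R M\<rparr>)"
  unfolding stable_module_def
proof (intro allI impI)
  let ?N = "M\<lparr>carrier := reject R M\<rparr>"
  fix H K
  assume "direct_decomposition R ?N H K \<and> projective_module R (?N\<lparr>carrier := H\<rparr>)"
  then have dd: "direct_decomposition R ?N H K" and proj: "projective_module R (M\<lparr>carrier := H\<rparr>)"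
    by simp_all
  have N: "submodule (reject R M) R M" using assms(2) by (simp add: direct_decomposition_def)
  have Nmod: "left_module R ?N" by (rule left_module_submodule[OF assms(1) N])
  have HN: "H \<subseteq> reject R M" "\<zero>\<^bsub>M\<^esub> \<in> H"
    using dd submoduleD(1,2)[of H R ?N] by (auto simp: direct_decomposition_def)
  obtain p where p: "p \<in> module_hom R M M" "\<And>x. x \<in> carrier M \<Longrightarrow> p x \<in> reject R M"
    "\<And>x. x \<in> reject R M \<Longrightarrow> p x = x"
    using decomposition_projection[OF assms(1) direct_decomposition_commute[OF assms]] by blast
  obtain q where q: "q \<in> module_hom R ?N ?N" "\<And>x. x \<in> carrier ?N \<Longrightarrow> q x \<in> H"
    "\<And>x. x \<in> H \<Longrightarrow> q x = x"
    using decomposition_projection[OF Nmod dd] by blast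
  obtain I :: "'b set" and b c where bas: "dual_basis R (M\<lparr>carrier := H\<rparr>) I b c"
    using projective_module_dual_basis[OF proj] by blast
  have Hmod: "left_module R (M\<lparr>carrier := H\<rparr>)" using proj by (simp add: projective_module_def)
  have p': "p \<in> module_hom R M ?N" using p(1,2) by (auto simp: module_hom_def)
  have q': "q \<in> module_hom R ?N (M\<lparr>carrier := H\<rparr>)" using q(1,2) by (auto simp: module_hom_def)
  have "x \<in> {\<zero>\<^bsub>M\<^esub>}" if x: "x \<in> H" for x
  proof -
    have xN: "x \<in> reject R M" "x \<in> carrier M"
      using x HN submoduleD(1)[OF N] by auto
    have "x = \<zero>\<^bsub>M\<lparr>carrier := H\<rparr>\<^esub>"
    proof (rule dual_basis_separates[OF Hmod bas])
      fix i assume i: "i \<in> I"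
      have "(\<lambda>y. c i (q (p y))) \<in> module_hom R M (regular_module R)"
        using module_hom_comp[OF module_hom_comp[OF p' q'] dual_basisD(2)[OF bas i]] .
      from restrict_functional_in_dual[OF assms(1) this]
      have "restrict (\<lambda>y. c i (q (p y))) (carrier M) x = \<zero>\<^bsub>R\<^esub>"
        using xN(1) by (auto simp: reject_def)
      then show "c i x = \<zero>\<^bsub>R\<^esub>" using xN(2) p(3)[OF xN(1)] q(3)[OF x] by simp
    qed (use x in simp)
    then show ?thesis by simp
  qed
  then have "H \<subseteq> {\<zero>\<^bsub>M\<^esub>}" by (rule subsetI)
  with HN(2) show "H = {\<zero>\<^bsub>?N\<^esub>}" by auto
qed

lemma evaluation_kernel:
  "m \<in> carrier M \<Longrightarrow> evaluation R M m = \<zero>\<^bsub>bidual R M\<^esub> \<longleftrightarrow> m \<in> reject R M"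
  by (auto simp: evaluation_def reject_def dual_module_simps(2) fun_eq_iff restrict_def)

text \<open>
  The endomorphism \<open>e m = \<Sum> \<phi>\<^sub>i(m) x\<^sub>i\<close> is indistinguishable from the identity by functionals.
  As \<open>e m\<close> depends only on the values \<open>\<phi>\<^sub>i(m)\<close>, it is idempotent, and its kernel consists of
  the elements that all functionals kill.
\<close>

lemma evaluation_basis_splits:
  fixes M :: "('a, 'b, 'm) module_scheme"
  assumes "left_module R M" "evaluation_basis R M I x \<phi>"
  shows "\<exists>P. direct_decomposition R M P (reject R M) \<and> projective_module R (M\<lparr>carrier := P\<rparr>) \<and>
    module_isomorphic R (M\<lparr>carrier := P\<rparr>) (bidual R M)"
proof (intro exI conjI)
  interpret left_module R M by fact
  note E = evaluation_basisD[OF assms(2)]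
  define e where "e m = finsum M (\<lambda>i. \<phi> i m \<odot>\<^bsub>M\<^esub> x i) I" for m
  have e: "e \<in> module_hom R M M"
    unfolding e_def
  proof (rule module_hom_sum[OF assms(1,1)])
    fix i assume i: "i \<in> I"
    note h = module_hom_add[OF dual_functional[OF E(3)[OF i]]]
      module_hom_smult[OF dual_functional[OF E(3)[OF i]]]
    show "(\<lambda>m. \<phi> i m \<odot>\<^bsub>M\<^esub> x i) \<in> module_hom R M M"
      using E(2,4)[OF i] h by (intro module_homI) (simp_all add: smult_l_distr smult_assoc1)
  qed
  have ec: "e m \<in> carrier M" if "m \<in> carrier M" for m
    using module_hom_closed[OF e that] .
  have psi_e: "\<psi> (e m) = \<psi> m" if "\<psi> \<in> carrier (dual_module R M)" "m \<in> carrier M" for \<psi> m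
    using E(5)[OF that] by (simp add: e_def)
  have idem: "e (e m) = e m" if "m \<in> carrier M" for m
    unfolding e_def[of "e m"] unfolding e_def[of m]
    using E(2,4) E(5)[OF E(3) that] that by (intro M.finsum_cong') auto
  have ker: "a_kernel M M e = reject R M"
  proof (intro equalityI subsetI)
    fix m assume "m \<in> a_kernel M M e"
    then have m: "m \<in> carrier M" "e m = \<zero>\<^bsub>M\<^esub>" by (auto simp: a_kernel_def')
    have "\<psi> m = \<zero>\<^bsub>R\<^esub>" if \<psi>: "\<psi> \<in> carrier (dual_module R M)" for \<psi>
      using psi_e[OF \<psi> m(1)] m(2)
        module_hom_zero[OF assms(1) left_module_regular[OF R.ring_axioms] dual_functional[OF \<psi>]]
      by simp
    with m(1) show "m \<in> reject R M" by (simp add: reject_def)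
  next
    fix m assume m: "m \<in> reject R M"
    have "e m = finsum M (\<lambda>i. \<zero>\<^bsub>M\<^esub>) I"
    proof -
      have "\<phi> i m = \<zero>\<^bsub>R\<^esub>" if "i \<in> I" for i using m E(3)[OF that] by (auto simp: reject_def)
      then show ?thesis unfolding e_def using E(2) by (intro M.finsum_cong') auto
    qed
    with m show "m \<in> a_kernel M M e" by (simp add: a_kernel_def' reject_def)
  qed
  show dd: "direct_decomposition R M (e ` carrier M) (reject R M)"
    using idempotent_decomposition[OF assms(1) e idem] by (simp add: ker)
  let ?P = "M\<lparr>carrier := e ` carrier M\<rparr>"
  have sub: "submodule (e ` carrier M) R M" by (rule submodule_image[OF assms(1,1) e])
  have P: "left_module R ?P" by (rule left_module_submodule[OF assms(1) sub])
  interpret P: left_module R ?P by (rule P)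
  have incl: "(\<lambda>m. m) \<in> module_hom R ?P M"
    by (rule module_hom_inclusion[OF submoduleD(1)[OF sub]])
  have "dual_basis R ?P I (\<lambda>i. e (x i)) \<phi>"
  proof (rule finite_dual_basisI[OF P E(1)])
    fix m assume m: "m \<in> carrier ?P"
    then have mM: "m \<in> carrier M" and em: "e m = m" using ec idem by auto
    have cl: "(\<lambda>i. \<phi> i m \<odot>\<^bsub>M\<^esub> e (x i)) \<in> I \<rightarrow> carrier ?P"
      using E(2,4) mM submoduleD(4)[OF sub] by auto
    have "finsum ?P (\<lambda>i. \<phi> i m \<odot>\<^bsub>?P\<^esub> e (x i)) I = finsum M (\<lambda>i. \<phi> i m \<odot>\<^bsub>M\<^esub> e (x i)) I"
      using module_hom_finsum[OF P assms(1) incl cl] by simp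
    also have "\<dots> = finsum M (\<lambda>i. e (\<phi> i m \<odot>\<^bsub>M\<^esub> x i)) I"
      using E(2,4) mM module_hom_smult[OF e] ec by (intro M.finsum_cong') auto
    also have "\<dots> = e (e m)"
      unfolding e_def[of m] using E(2,4) mM
      by (intro module_hom_finsum[OF assms(1,1) e, symmetric]) auto
    finally show "finsum ?P (\<lambda>i. \<phi> i m \<odot>\<^bsub>?P\<^esub> e (x i)) I = m" by (simp add: em)
  next
    fix i assume i: "i \<in> I"
    show "\<phi> i \<in> module_hom R ?P (regular_module R)"
      using module_hom_comp[OF incl dual_functional[OF E(3)[OF i]]] .
  qed (use E(2) in auto)
  then show "projective_module R ?P"
    using P E(1) by (intro finite_dual_basis_projective)
  let ?ev = "evaluation R M"
  have ev: "?ev \<in> module_hom R ?P (bidual R M)"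
    using module_hom_comp[OF incl evaluation_hom[OF assms(1)]] .
  have "inj_on ?ev (carrier ?P)"
  proof (rule module_hom_inj_onI[OF P left_module_bidual[OF assms(1)] ev])
    fix m assume m: "m \<in> carrier ?P" "?ev m = \<zero>\<^bsub>bidual R M\<^esub>"
    then have "m \<in> e ` carrier M \<inter> reject R M" using ec evaluation_kernel by fastforce
    then show "m = \<zero>\<^bsub>?P\<^esub>" using dd by (auto simp: direct_decomposition_def)
  qed
  moreover have "?ev ` carrier ?P = carrier (bidual R M)"
  proof -
    have "?ev (e m) = ?ev m" if "m \<in> carrier M" for m
      using psi_e that by (auto simp: evaluation_def intro!: restrict_ext)
    then have "?ev ` carrier ?P = ?ev ` carrier M" by (auto simp: image_image)
    then show ?thesis using evaluation_surjective[OF assms] by simp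
  qed
  ultimately show "module_isomorphic R ?P (bidual R M)"
    using ev by (auto simp: module_isomorphic_def bij_betw_def)
qed

section \<open>Finitely presented modules over the opposite of a semihereditary ring\<close>

lemma finitely_generated_image:
  assumes "left_module R X" "left_module R Y" "h \<in> module_hom R X Y" "finitely_generated R X"
  shows "finitely_generated R (Y\<lparr>carrier := h ` carrier X\<rparr>)"
proof -
  let ?I = "Y\<lparr>carrier := h ` carrier X\<rparr>"
  have I: "left_module R ?I"
    by (rule left_module_submodule[OF assms(2) submodule_image[OF assms(1-3)]])
  have h: "h \<in> module_hom R X ?I" using assms(3) by (auto simp: module_hom_def)
  obtain A where A: "finite A" "A \<subseteq> carrier X"
    "\<And>H. submodule H R X \<Longrightarrow> A \<subseteq> H \<Longrightarrow> H = carrier X"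
    using assms(4) by (auto simp: finitely_generated_def)
  have "H = carrier ?I" if H: "submodule H R ?I" "h ` A \<subseteq> H" for H
  proof -
    have "{x \<in> carrier X. h x \<in> H} = carrier X"
      using A(2) H(2) by (intro A(3) submodule_vimage[OF assms(1) I h H(1)]) auto
    then show ?thesis using submoduleD(1)[OF H(1)] by auto
  qed
  then show ?thesis
    unfolding finitely_generated_def using A(1,2) by (intro exI[of _ "h ` A"]) auto
qed

text \<open>
  The image of a functional on a finitely generated module is a finitely generated left ideal,
  hence projective, so the functional splits over its image. Only \<open>s \<circ> h\<close> is recorded as a
  homomorphism, since \<open>s\<close> is defined on that ideal.
\<close>

lemma semihereditary_functional_section:
  assumes "left_semihereditary R" "left_module R Y" "finitely_generated R Y"
    and "h \<in> module_hom R Y (regular_module R)"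
  obtains s where "(\<lambda>y. s (h y)) \<in> module_hom R Y Y" "\<And>y. y \<in> carrier Y \<Longrightarrow> h (s (h y)) = h y"
    "s \<zero>\<^bsub>R\<^esub> = \<zero>\<^bsub>Y\<^esub>"
proof -
  interpret left_module R Y by fact
  let ?R = "regular_module R"
  let ?I = "?R\<lparr>carrier := h ` carrier Y\<rparr>"
  have R: "left_module R ?R" by (rule left_module_regular[OF R.ring_axioms])
  have sub: "submodule (h ` carrier Y) R ?R" by (rule submodule_image[OF assms(2) R assms(4)])
  have "projective_module R ?I"
    using assms(1) sub finitely_generated_image[OF assms(2) R assms(4,3)]
    by (auto simp: left_semihereditary_def)
  then obtain J :: "'a set" and b c where bas: "dual_basis R ?I J b c"
    using projective_module_dual_basis by blast
  have I: "left_module R ?I" by (rule left_module_submodule[OF R sub])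
  have incl: "(\<lambda>r. r) \<in> module_hom R ?I ?R" by (rule module_hom_inclusion[OF submoduleD(1)[OF sub]])
  obtain s where s: "s \<in> module_hom R ?I Y" "\<And>r. r \<in> carrier ?I \<Longrightarrow> h (s r) = r"
    using dual_basis_lift[OF I assms(2) R bas incl assms(4)] by auto
  have "h \<in> module_hom R Y ?I" using assms(4) by (auto simp: module_hom_def)
  from module_hom_comp[OF this s(1)] show thesis
    using s(2) module_hom_zero[OF I assms(2) s(1)] by (intro that[of s]) auto
qed

text \<open>
  Induction on the number of functionals: if \<open>E\<close> projects onto the common kernel of the first
  ones and \<open>s\<close> splits \<open>h\<^sub>n \<circ> E\<close> over its image, then \<open>E - E \<circ> s \<circ> h\<^sub>n \<circ> E\<close> projects onto the
  common kernel that includes \<open>h\<^sub>n\<close>.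
\<close>

lemma semihereditary_common_kernel_summand:
  fixes h :: "nat \<Rightarrow> 'b \<Rightarrow> 'a"
  assumes "left_semihereditary R" "left_module R Y" "finitely_generated R Y"
    and "\<And>k. k < n \<Longrightarrow> h k \<in> module_hom R Y (regular_module R)"
  shows "\<exists>E\<in>module_hom R Y Y. (\<forall>y\<in>carrier Y. \<forall>k<n. h k (E y) = \<zero>\<^bsub>R\<^esub>) \<and>
    (\<forall>y\<in>carrier Y. (\<forall>k<n. h k y = \<zero>\<^bsub>R\<^esub>) \<longrightarrow> E y = y)"
  using assms(4)
proof (induction n)
  case 0
  then show ?case using module_hom_id by (intro bexI[of _ "\<lambda>y. y"]) auto
next
  case (Suc n)
  interpret left_module R Y by fact
  have R: "left_module R (regular_module R)" by (rule left_module_regular[OF R.ring_axioms])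
  obtain E where E: "E \<in> module_hom R Y Y"
    "\<And>y k. y \<in> carrier Y \<Longrightarrow> k < n \<Longrightarrow> h k (E y) = \<zero>\<^bsub>R\<^esub>"
    "\<And>y. y \<in> carrier Y \<Longrightarrow> \<forall>k<n. h k y = \<zero>\<^bsub>R\<^esub> \<Longrightarrow> E y = y"
    using Suc.IH Suc.prems by (metis less_SucI)
  have hn: "h n \<in> module_hom R Y (regular_module R)" using Suc.prems by simp
  note hE = module_hom_comp[OF E(1) hn]
  obtain s where s: "(\<lambda>y. s (h n (E y))) \<in> module_hom R Y Y"
    "\<And>y. y \<in> carrier Y \<Longrightarrow> h n (E (s (h n (E y)))) = h n (E y)" "s \<zero>\<^bsub>R\<^esub> = \<zero>\<^bsub>Y\<^esub>"
    using semihereditary_functional_section[OF assms(1-3) hE] by blast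
  let ?F = "\<lambda>y. E y \<ominus>\<^bsub>Y\<^esub> E (s (h n (E y)))"
  note Es = module_hom_comp[OF s(1) E(1)]
  have sc: "s (h n (E y)) \<in> carrier Y" if "y \<in> carrier Y" for y
    using module_hom_closed[OF s(1) that] .
  have hF: "h k (?F y) = h k (E y) \<ominus>\<^bsub>R\<^esub> h k (E (s (h n (E y))))"
    if "y \<in> carrier Y" "k < Suc n" for y k
    using module_hom_diff[OF assms(2) R Suc.prems[OF that(2)] module_hom_closed[OF E(1) that(1)]
        module_hom_closed[OF E(1) sc[OF that(1)]]]
    by simp
  show ?case
  proof (intro bexI[of _ ?F] conjI ballI allI impI)
    show "?F \<in> module_hom R Y Y" by (rule module_hom_pointwise_diff[OF assms(2,2) E(1) Es])
  next
    fix y k assume y: "y \<in> carrier Y" and k: "k < Suc n"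
    have c: "h n (E y) \<in> carrier R" using module_hom_closed[OF hE y] by simp
    show "h k (?F y) = \<zero>\<^bsub>R\<^esub>"
    proof (cases "k = n")
      case True
      then show ?thesis using hF[OF y k] s(2)[OF y] c by (simp add: a_minus_def R.r_neg)
    next
      case False
      then show ?thesis using hF[OF y k] E(2)[OF y] E(2)[OF sc[OF y]] k
        by (simp add: a_minus_def)
    qed
  next
    fix y assume y: "y \<in> carrier Y" "\<forall>k<Suc n. h k y = \<zero>\<^bsub>R\<^esub>"
    then have "E y = y" using E(3) by simp
    then show "?F y = y"
      using y s(3) module_hom_zero[OF assms(2,2) E(1)] by (simp add: a_minus_def)
  qed
qed

text \<open>
  \<open>M*\<close> embeds into the dual \<open>?Y\<close> of the free module as the functionals that vanish on the
  relations \<open>f (d k)\<close>. With the projection \<open>p\<close> of \<open>?Y\<close> onto this summand, the functionals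
  \<open>p (\<pi> i)\<close> factor through \<open>g\<close> and give the \<open>\<phi> i\<close>; a functional \<open>\<psi>\<close> on \<open>M\<close> is recovered by applying
  \<open>p\<close> to the expansion \<open>\<psi> \<circ> g = \<Sum> \<psi>(g(e\<^sub>i)) \<pi>\<^sub>i\<close>.
\<close>

lemma finitely_presented_evaluation_basis:
  fixes M :: "('a, 'b, 'm) module_scheme"
  assumes "left_semihereditary (op_ring R)" "left_module R M" "finitely_presented R M"
  obtains I :: "nat set" and x \<phi> where "evaluation_basis R M I x \<phi>"
proof -
  interpret left_module R M by fact
  obtain m n :: nat and f g
    where f: "f \<in> module_hom R (free_module R {..<m}) (free_module R {..<n})"
      and g: "g \<in> module_hom R (free_module R {..<n}) M"
      and im: "f ` carrier (free_module R {..<m}) = a_kernel (free_module R {..<n}) M g"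
      and surj: "g ` carrier (free_module R {..<n}) = carrier M"
    using assms(3) by (auto simp: finitely_presented_def)
  let ?G = "free_module R {..<m}" and ?F = "free_module R {..<n}"
  have G: "left_module R ?G" and F: "left_module R ?F" and Rr: "left_module R (regular_module R)"
    using R.ring_axioms by (auto intro: left_module_free_module left_module_regular)
  obtain d c where basG: "dual_basis R ?G {..<m} d c"
    using dual_basis_free_module[OF R.ring_axioms] by blast
  obtain e \<pi> where E: "evaluation_basis R ?F {..<n} e \<pi>"
    using finite_dual_basis_evaluation_basis[OF F dual_basis_free_module[OF R.ring_axioms]] by blast
  note DE = evaluation_basisD[OF E]
  let ?Y = "dual_module R ?F"
  have Y: "left_module (op_ring R) ?Y" by (rule left_module_dual_module[OF F])
  note basY = dual_basis_of_dual[OF F E]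
  have fgY: "finitely_generated (op_ring R) ?Y"
    by (rule finite_dual_basis_finitely_generated[OF Y basY]) simp
  have fd: "f (d k) \<in> carrier ?F" if "k < m" for k
    using module_hom_closed[OF f] dual_basisD(1)[OF basG] that by simp
  obtain p where p: "p \<in> module_hom (op_ring R) ?Y ?Y"
    "\<And>\<chi> k. \<chi> \<in> carrier ?Y \<Longrightarrow> k < m \<Longrightarrow> p \<chi> (f (d k)) = \<zero>\<^bsub>R\<^esub>"
    "\<And>\<chi>. \<chi> \<in> carrier ?Y \<Longrightarrow> \<forall>k<m. \<chi> (f (d k)) = \<zero>\<^bsub>R\<^esub> \<Longrightarrow> p \<chi> = \<chi>"
    using semihereditary_common_kernel_summand[OF assms(1) Y fgY, of m "\<lambda>k \<chi>. \<chi> (f (d k))",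
        OF evaluation_functional[OF fd]] by auto
  have pY: "p \<chi> \<in> carrier ?Y" if "\<chi> \<in> carrier ?Y" for \<chi>
    using module_hom_closed[OF p(1) that] .
  \<comment> \<open>\<open>p \<chi>\<close> vanishes on the images of the basis elements of \<open>?G\<close>, and these span the relations\<close>
  have kill: "p \<chi> y = \<zero>\<^bsub>R\<^esub>" if \<chi>: "\<chi> \<in> carrier ?Y" and y: "y \<in> a_kernel ?F M g" for \<chi> y
  proof -
    obtain z where z: "z \<in> carrier ?G" "y = f z" using y im by auto
    note hom = module_hom_comp[OF f dual_functional[OF pY[OF \<chi>]]]
    interpret G: left_module R ?G by (rule G)
    have "p \<chi> (f z) = p \<chi> (f (finsum ?G (\<lambda>k. c k z \<odot>\<^bsub>?G\<^esub> d k) {..<m}))"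
      using dual_basis_finite_sum[OF G basG _ z(1)] by simp
    also have "\<dots> = finsum R (\<lambda>k. p \<chi> (f (c k z \<odot>\<^bsub>?G\<^esub> d k))) {..<m}"
      using module_hom_finsum[OF G Rr hom, of "\<lambda>k. c k z \<odot>\<^bsub>?G\<^esub> d k" "{..<m}"]
        dual_basisD(1,3)[OF basG] z(1) by auto
    also have "\<dots> = finsum R (\<lambda>k. \<zero>\<^bsub>R\<^esub>) {..<m}"
      using module_hom_smult[OF hom] dual_basisD(1,3)[OF basG] z(1) p(2)[OF \<chi>]
      by (intro R.finsum_cong') auto
    finally show ?thesis by (simp add: z(2))
  qed
  have "\<exists>\<phi>\<in>carrier (dual_module R M). \<forall>y\<in>carrier ?F. \<phi> (g y) = p (\<pi> i) y" if i: "i < n" for i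
  proof -
    have \<pi>: "\<pi> i \<in> carrier ?Y" using DE(3) i by simp
    obtain k where k: "k \<in> module_hom R M (regular_module R)"
      "\<And>y. y \<in> carrier ?F \<Longrightarrow> k (g y) = p (\<pi> i) y"
      using module_hom_factors_through_surjection[OF F assms(2) Rr g surj
          dual_functional[OF pY[OF \<pi>]]] kill[OF \<pi>] by auto
    show ?thesis
      using restrict_functional_in_dual[OF assms(2) k(1)] k(2) module_hom_closed[OF g]
      by (intro bexI[of _ "restrict k (carrier M)"]) auto
  qed
  then obtain \<phi> where \<phi>: "\<And>i. i < n \<Longrightarrow> \<phi> i \<in> carrier (dual_module R M)"
    "\<And>i y. i < n \<Longrightarrow> y \<in> carrier ?F \<Longrightarrow> \<phi> i (g y) = p (\<pi> i) y"
    by metis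
  have "evaluation_basis R M {..<n} (\<lambda>i. g (e i)) \<phi>"
    unfolding evaluation_basis_def
  proof (intro conjI ballI)
    show "(\<lambda>i. g (e i)) \<in> {..<n} \<rightarrow> carrier M" using module_hom_closed[OF g] DE(2) by auto
    show "\<phi> \<in> {..<n} \<rightarrow> carrier (dual_module R M)" using \<phi>(1) by auto
    fix \<psi> m' assume \<psi>: "\<psi> \<in> carrier (dual_module R M)" and "m' \<in> carrier M"
    then obtain y where y: "y \<in> carrier ?F" "m' = g y" using surj by auto
    let ?\<chi> = "restrict (\<lambda>y. \<psi> (g y)) (carrier ?F)"
    have \<chi>: "?\<chi> \<in> carrier ?Y"
      by (rule restrict_functional_in_dual[OF F module_hom_comp[OF g dual_functional[OF \<psi>]]])
    have "?\<chi> (f (d k)) = \<zero>\<^bsub>R\<^esub>" if k: "k < m" for k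
    proof -
      have "f (d k) \<in> a_kernel ?F M g" using im dual_basisD(1)[OF basG] k by auto
      then have "g (f (d k)) = \<zero>\<^bsub>M\<^esub>" by (simp add: a_kernel_def')
      then show ?thesis
        using fd[OF k] module_hom_zero[OF assms(2) Rr dual_functional[OF \<psi>]] by simp
    qed
    then have fixed: "p ?\<chi> = ?\<chi>" by (intro p(3)[OF \<chi>]) blast
    have c': "(\<lambda>i. ?\<chi> (e i) \<odot>\<^bsub>?Y\<^esub> \<pi> i) \<in> {..<n} \<rightarrow> carrier ?Y"
      using left_module.smult_closed[OF Y] dual_functional_closed[OF \<chi>] DE(2,3) by auto
    have "?\<chi> = p (finsum ?Y (\<lambda>i. ?\<chi> (e i) \<odot>\<^bsub>?Y\<^esub> \<pi> i) {..<n})"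
      using dual_basis_finite_sum[OF Y basY _ \<chi>] fixed by simp
    also have "\<dots> = finsum ?Y (\<lambda>i. p (?\<chi> (e i) \<odot>\<^bsub>?Y\<^esub> \<pi> i)) {..<n}"
      by (rule module_hom_finsum[OF Y Y p(1) c'])
    finally have "?\<chi> y = finsum ?Y (\<lambda>i. p (?\<chi> (e i) \<odot>\<^bsub>?Y\<^esub> \<pi> i)) {..<n} y"
      by (rule fun_cong)
    also have "\<dots> = finsum R (\<lambda>i. p (?\<chi> (e i) \<odot>\<^bsub>?Y\<^esub> \<pi> i) y) {..<n}"
      using c' pY by (intro dual_finsum_apply[OF F _ y(1)]) auto
    also have "\<dots> = finsum R (\<lambda>i. \<phi> i (g y) \<otimes>\<^bsub>R\<^esub> \<psi> (g (e i))) {..<n}"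
    proof (rule R.finsum_cong')
      show "(\<lambda>i. \<phi> i (g y) \<otimes>\<^bsub>R\<^esub> \<psi> (g (e i))) \<in> {..<n} \<rightarrow> carrier R"
        using dual_functional_closed[OF \<phi>(1)] dual_functional_closed[OF \<psi>]
          module_hom_closed[OF g] y(1) DE(2) by auto
      fix i assume i: "i \<in> {..<n}"
      have "p (?\<chi> (e i) \<odot>\<^bsub>?Y\<^esub> \<pi> i) = ?\<chi> (e i) \<odot>\<^bsub>?Y\<^esub> p (\<pi> i)"
        using module_hom_smult[OF p(1)] dual_functional_closed[OF \<chi> DE(2)[OF i]] DE(3)[OF i] by simp
      then show "p (?\<chi> (e i) \<odot>\<^bsub>?Y\<^esub> \<pi> i) y = \<phi> i (g y) \<otimes>\<^bsub>R\<^esub> \<psi> (g (e i))"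
        using y(1) i \<phi>(2) DE(2)[OF i] by (simp add: dual_module_simps(4))
    qed simp
    also have "\<dots> = \<psi> (finsum M (\<lambda>i. \<phi> i (g y) \<odot>\<^bsub>M\<^esub> g (e i)) {..<n})"
      using dual_functional_closed[OF \<phi>(1)] module_hom_closed[OF g] y(1) DE(2)
      by (intro functional_linear_combination[OF assms(2) \<psi>, symmetric]) auto
    finally show "\<psi> (finsum M (\<lambda>i. \<phi> i m' \<odot>\<^bsub>M\<^esub> g (e i)) {..<n}) = \<psi> m'"
      using y by simp
  qed simp
  then show thesis by (rule that)
qed

section \<open>Independence of the first extension module of the resolution\<close>

lemma minus_op_ring [simp]: "x \<ominus>\<^bsub>op_ring R\<^esub> y = x \<ominus>\<^bsub>R\<^esub> y"
  by (simp add: a_minus_def a_inv_def m_inv_def op_ring_def)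

lemma dual_minus_apply:
  assumes "left_module R X" "\<phi> \<in> carrier (dual_module R X)" "\<psi> \<in> carrier (dual_module R X)"
    "x \<in> carrier X"
  shows "(\<phi> \<ominus>\<^bsub>dual_module R X\<^esub> \<psi>) x = \<phi> x \<ominus>\<^bsub>R\<^esub> \<psi> x"
  using module_hom_diff[OF left_module_dual_module[OF assms(1)]
      left_module_regular[OF ring_op_ring[OF ring_of_left_module[OF assms(1)]]]
      evaluation_functional[OF assms(4)] assms(2,3)]
  by simp

lemma dual_map_apply [simp]: "x \<in> carrier X \<Longrightarrow> dual_map X h \<psi> x = \<psi> (h x)"
  by (simp add: dual_map_def compose_def)

lemma dual_map_hom:
  assumes "left_module R X" "left_module R Y" "h \<in> module_hom R X Y"
  shows "dual_map X h \<in> module_hom (op_ring R) (dual_module R Y) (dual_module R X)"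
proof (rule module_homI)
  fix \<phi> assume \<phi>: "\<phi> \<in> carrier (dual_module R Y)"
  show "dual_map X h \<phi> \<in> carrier (dual_module R X)"
    using restrict_functional_in_dual[OF assms(1) module_hom_comp[OF assms(3) dual_functional[OF \<phi>]]]
    by (simp add: dual_map_def compose_def)
qed (auto simp: dual_map_def compose_def dual_module_simps(3,4) module_hom_closed[OF assms(3)]
    intro!: restrict_ext)

text \<open>
  Exactness of \<open>Q2 \<rightarrow> Q1 \<rightarrow> Q0 \<rightarrow> X \<rightarrow> 0\<close>. Projectivity is kept apart, because the comparison
  argument uses it for \<open>Q0\<close> and \<open>Q1\<close> and is applied to a sequence that starts with \<open>M*\<close>.
\<close>

definition partial_resolution ::
  "('a, 'r) ring_scheme \<Rightarrow> ('a, 'q2, 'm2) module_scheme \<Rightarrow> ('a, 'q1, 'm1) module_scheme \<Rightarrow>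
   ('a, 'q0, 'm0) module_scheme \<Rightarrow> ('a, 'b, 'm) module_scheme \<Rightarrow>
   ('q2 \<Rightarrow> 'q1) \<Rightarrow> ('q1 \<Rightarrow> 'q0) \<Rightarrow> ('q0 \<Rightarrow> 'b) \<Rightarrow> bool"
  where "partial_resolution R Q2 Q1 Q0 X d2 d1 e \<longleftrightarrow>
    left_module R Q2 \<and> left_module R Q1 \<and> left_module R Q0 \<and> left_module R X \<and>
    d2 \<in> module_hom R Q2 Q1 \<and> d1 \<in> module_hom R Q1 Q0 \<and> e \<in> module_hom R Q0 X \<and>
    d2 ` carrier Q2 = a_kernel Q1 Q0 d1 \<and>
    d1 ` carrier Q1 = a_kernel Q0 X e \<and>
    e ` carrier Q0 = carrier X"

lemma partial_resolutionD:
  assumes "partial_resolution R Q2 Q1 Q0 X d2 d1 e"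
  shows "left_module R Q2" "left_module R Q1" "left_module R Q0" "left_module R X"
    "d2 \<in> module_hom R Q2 Q1" "d1 \<in> module_hom R Q1 Q0" "e \<in> module_hom R Q0 X"
    "d2 ` carrier Q2 = a_kernel Q1 Q0 d1" "d1 ` carrier Q1 = a_kernel Q0 X e"
    "e ` carrier Q0 = carrier X"
    "\<And>y. y \<in> carrier Q2 \<Longrightarrow> d1 (d2 y) = \<zero>\<^bsub>Q0\<^esub>"
    "\<And>x. x \<in> carrier Q1 \<Longrightarrow> e (d1 x) = \<zero>\<^bsub>X\<^esub>"
  using assms by (auto simp: partial_resolution_def a_kernel_def')

definition cocycles ::
  "('a, 'r) ring_scheme \<Rightarrow> ('a, 'q2, 'm2) module_scheme \<Rightarrow> ('a, 'q1, 'm1) module_scheme \<Rightarrow>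
   ('q2 \<Rightarrow> 'q1) \<Rightarrow> ('q1 \<Rightarrow> 'a) set"
  where "cocycles R Q2 Q1 d2 = a_kernel (dual_module R Q1) (dual_module R Q2) (dual_map Q2 d2)"

definition coboundaries ::
  "('a, 'r) ring_scheme \<Rightarrow> ('a, 'q1, 'm1) module_scheme \<Rightarrow> ('a, 'q0, 'm0) module_scheme \<Rightarrow>
   ('q1 \<Rightarrow> 'q0) \<Rightarrow> ('q1 \<Rightarrow> 'a) set"
  where "coboundaries R Q1 Q0 d1 = dual_map Q1 d1 ` carrier (dual_module R Q0)"

lemma Ext1_self_eq:
  "Ext1_self R Q2 Q1 Q0 d2 d1 =
    quotient_module ((dual_module R Q1)\<lparr>carrier := cocycles R Q2 Q1 d2\<rparr>) (coboundaries R Q1 Q0 d1)"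
  by (simp add: Ext1_self_def cocycles_def coboundaries_def)

lemma cocycles_iff:
  "\<psi> \<in> cocycles R Q2 Q1 d2 \<longleftrightarrow>
    \<psi> \<in> carrier (dual_module R Q1) \<and> (\<forall>y\<in>carrier Q2. \<psi> (d2 y) = \<zero>\<^bsub>R\<^esub>)"
  by (auto simp: cocycles_def a_kernel_def' dual_map_def compose_def dual_module_simps(2)
      fun_eq_iff restrict_def)

text \<open>
  The quantifier ranges over homomorphisms instead of the extensional elements of the dual, so
  that functionals can be composed with chain maps without restricting them.
\<close>

lemma coboundaries_iff:
  assumes "left_module R Q1" "left_module R Q0" "d1 \<in> module_hom R Q1 Q0"
  shows "\<psi> \<in> coboundaries R Q1 Q0 d1 \<longleftrightarrow>
    \<psi> \<in> carrier (dual_module R Q1) \<and>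
    (\<exists>l\<in>module_hom R Q0 (regular_module R). \<forall>x\<in>carrier Q1. \<psi> x = l (d1 x))"
proof
  assume "\<psi> \<in> coboundaries R Q1 Q0 d1"
  then obtain l where l: "l \<in> carrier (dual_module R Q0)" "\<psi> = dual_map Q1 d1 l"
    by (auto simp: coboundaries_def)
  then show "\<psi> \<in> carrier (dual_module R Q1) \<and>
    (\<exists>l\<in>module_hom R Q0 (regular_module R). \<forall>x\<in>carrier Q1. \<psi> x = l (d1 x))"
    using module_hom_closed[OF dual_map_hom[OF assms] l(1)] dual_functional[OF l(1)] by auto
next
  assume R: "\<psi> \<in> carrier (dual_module R Q1) \<and>
    (\<exists>l\<in>module_hom R Q0 (regular_module R). \<forall>x\<in>carrier Q1. \<psi> x = l (d1 x))"
  then obtain l where l: "l \<in> module_hom R Q0 (regular_module R)"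
    "\<And>x. x \<in> carrier Q1 \<Longrightarrow> \<psi> x = l (d1 x)" by auto
  let ?l = "restrict l (carrier Q0)"
  have l': "?l \<in> carrier (dual_module R Q0)"
    by (rule restrict_functional_in_dual[OF assms(2) l(1)])
  have "\<psi> = dual_map Q1 d1 ?l"
    using l(2) module_hom_closed[OF assms(3)]
    by (intro dual_eqI[OF conjunct1[OF R] module_hom_closed[OF dual_map_hom[OF assms] l']]) simp
  with l' show "\<psi> \<in> coboundaries R Q1 Q0 d1" by (auto simp: coboundaries_def)
qed

lemma cocycles_submodule:
  assumes "partial_resolution R Q2 Q1 Q0 X d2 d1 e"
  shows "submodule (cocycles R Q2 Q1 d2) (op_ring R) (dual_module R Q1)"
  unfolding cocycles_def
  using partial_resolutionD(1,2,5)[OF assms]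
  by (intro submodule_kernel left_module_dual_module dual_map_hom)

lemma coboundaries_submodule:
  assumes "partial_resolution R Q2 Q1 Q0 X d2 d1 e"
  shows "submodule (coboundaries R Q1 Q0 d1) (op_ring R)
    ((dual_module R Q1)\<lparr>carrier := cocycles R Q2 Q1 d2\<rparr>)"
proof -
  note Q = partial_resolutionD[OF assms]
  have B: "submodule (coboundaries R Q1 Q0 d1) (op_ring R) (dual_module R Q1)"
    unfolding coboundaries_def
    using Q by (intro submodule_image left_module_dual_module dual_map_hom)
  note Zmod = left_module_submodule[OF left_module_dual_module[OF Q(2)] cocycles_submodule[OF assms]]
  have "\<psi> \<in> cocycles R Q2 Q1 d2" if \<psi>: "\<psi> \<in> coboundaries R Q1 Q0 d1" for \<psi>
  proof -
    obtain l where l: "l \<in> module_hom R Q0 (regular_module R)"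
      "\<And>x. x \<in> carrier Q1 \<Longrightarrow> \<psi> x = l (d1 x)" and d: "\<psi> \<in> carrier (dual_module R Q1)"
      using \<psi> coboundaries_iff[OF Q(2,3,6)] by auto
    have "l \<zero>\<^bsub>Q0\<^esub> = \<zero>\<^bsub>R\<^esub>"
      using module_hom_zero[OF Q(3) left_module_regular[OF ring_of_left_module[OF Q(3)]] l(1)] by simp
    then show ?thesis
      using d l(2) Q(11) module_hom_closed[OF Q(5)] by (simp add: cocycles_iff)
  qed
  then show ?thesis
    using submoduleD[OF B] by (intro submoduleI[OF Zmod]) auto
qed

text \<open>
  The comparison theorem in low degrees: projectivity of \<open>Q0\<close> and \<open>Q1\<close> lifts the identity of
  \<open>X\<close> to a map of the two complexes.
\<close>

lemma comparison_map:
  assumes "partial_resolution R Q2 Q1 Q0 X d2 d1 e" "partial_resolution R Q2' Q1' Q0' X d2' d1' e'"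
    and "dual_basis R Q0 I0 b0 c0" "dual_basis R Q1 I1 b1 c1"
  obtains \<alpha>0 \<alpha>1 where "\<alpha>0 \<in> module_hom R Q0 Q0'" "\<alpha>1 \<in> module_hom R Q1 Q1'"
    "\<And>x. x \<in> carrier Q0 \<Longrightarrow> e' (\<alpha>0 x) = e x"
    "\<And>x. x \<in> carrier Q1 \<Longrightarrow> d1' (\<alpha>1 x) = \<alpha>0 (d1 x)"
proof -
  note Q = partial_resolutionD[OF assms(1)] and Q' = partial_resolutionD[OF assms(2)]
  obtain \<alpha>0 where a0: "\<alpha>0 \<in> module_hom R Q0 Q0'" "\<And>x. x \<in> carrier Q0 \<Longrightarrow> e' (\<alpha>0 x) = e x"
    using dual_basis_lift[OF Q(3) Q'(3) Q(4) assms(3) Q(7) Q'(7)] Q(10) Q'(10) by auto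
  note a0d1 = module_hom_comp[OF Q(6) a0(1)]
  have "(\<lambda>x. \<alpha>0 (d1 x)) ` carrier Q1 \<subseteq> d1' ` carrier Q1'"
    unfolding Q'(9) using a0 Q(12) module_hom_closed[OF a0d1] module_hom_closed[OF Q(6)]
    by (auto simp: a_kernel_def')
  then obtain \<alpha>1 where "\<alpha>1 \<in> module_hom R Q1 Q1'"
    "\<And>x. x \<in> carrier Q1 \<Longrightarrow> d1' (\<alpha>1 x) = \<alpha>0 (d1 x)"
    using dual_basis_lift[OF Q(2) Q'(2,3) assms(4) a0d1 Q'(6)] by auto
  with a0 show thesis by (intro that)
qed

text \<open>
  A self-map of the complex over the identity of \<open>X\<close> is homotopic to the identity, so it moves
  every cocycle within its cohomology class.
\<close>

lemma self_map_preserves_class: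
  assumes "partial_resolution R Q2 Q1 Q0 X d2 d1 e" "dual_basis R Q0 I0 b0 c0"
    and "\<gamma>0 \<in> module_hom R Q0 Q0" "\<gamma>1 \<in> module_hom R Q1 Q1"
    and "\<And>x. x \<in> carrier Q0 \<Longrightarrow> e (\<gamma>0 x) = e x"
    and "\<And>x. x \<in> carrier Q1 \<Longrightarrow> d1 (\<gamma>1 x) = \<gamma>0 (d1 x)"
    and "\<psi> \<in> cocycles R Q2 Q1 d2"
  obtains \<mu> where "\<mu> \<in> module_hom R Q0 (regular_module R)"
    "\<And>x. x \<in> carrier Q1 \<Longrightarrow> \<psi> (\<gamma>1 x) \<ominus>\<^bsub>R\<^esub> \<psi> x = \<mu> (d1 x)"
proof -
  note Q = partial_resolutionD[OF assms(1)]
  interpret Q0: left_module R Q0 by (rule Q(3))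
  interpret Q1: left_module R Q1 by (rule Q(2))
  interpret X: left_module R X by (rule Q(4))
  have Rr: "left_module R (regular_module R)" by (rule left_module_regular[OF Q0.R.ring_axioms])
  have \<psi>: "\<psi> \<in> module_hom R Q1 (regular_module R)" "\<And>y. y \<in> carrier Q2 \<Longrightarrow> \<psi> (d2 y) = \<zero>\<^bsub>R\<^esub>"
    using assms(7) by (auto simp: cocycles_iff dual_functional)
  note k = module_hom_pointwise_diff[OF Q(3,3) assms(3) module_hom_id]
  \<comment> \<open>the homotopy \<open>s\<close> is a lift of \<open>\<gamma>0 - id\<close>, whose values lie in the kernel of \<open>e\<close>\<close>
  have "(\<lambda>x. \<gamma>0 x \<ominus>\<^bsub>Q0\<^esub> x) ` carrier Q0 \<subseteq> d1 ` carrier Q1"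
    unfolding Q(9) using module_hom_eq_iff_diff_in_kernel[OF Q(3,4,7)] assms(5)
      module_hom_closed[OF assms(3)] by auto
  then obtain s where s: "s \<in> module_hom R Q0 Q1"
    "\<And>x. x \<in> carrier Q0 \<Longrightarrow> d1 (s x) = \<gamma>0 x \<ominus>\<^bsub>Q0\<^esub> x"
    using dual_basis_lift[OF Q(3,2,3) assms(2) k Q(6)] by auto
  have "\<psi> (\<gamma>1 x) \<ominus>\<^bsub>R\<^esub> \<psi> x = \<psi> (s (d1 x))" if x: "x \<in> carrier Q1" for x
  proof -
    have c: "d1 x \<in> carrier Q0" "\<gamma>1 x \<in> carrier Q1" "s (d1 x) \<in> carrier Q1"
      using x module_hom_closed[OF Q(6)] module_hom_closed[OF assms(4)] module_hom_closed[OF s(1)]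
      by auto
    have "d1 (\<gamma>1 x \<ominus>\<^bsub>Q1\<^esub> x) = d1 (s (d1 x))"
      using module_hom_diff[OF Q(2,3,6) c(2) x] assms(6)[OF x] s(2)[OF c(1)] by simp
    then have "(\<gamma>1 x \<ominus>\<^bsub>Q1\<^esub> x) \<ominus>\<^bsub>Q1\<^esub> s (d1 x) \<in> d2 ` carrier Q2"
      unfolding Q(8) using module_hom_eq_iff_diff_in_kernel[OF Q(2,3,6)] x c by auto
    then have "(\<gamma>1 x \<ominus>\<^bsub>Q1\<^esub> x) \<ominus>\<^bsub>Q1\<^esub> s (d1 x) \<in> a_kernel Q1 (regular_module R) \<psi>"
      using \<psi>(2) x c by (auto simp: a_kernel_def')
    then have "\<psi> (\<gamma>1 x \<ominus>\<^bsub>Q1\<^esub> x) = \<psi> (s (d1 x))"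
      using module_hom_eq_iff_diff_in_kernel[OF Q(2) Rr \<psi>(1)] x c by auto
    then show ?thesis using module_hom_diff[OF Q(2) Rr \<psi>(1) c(2) x] by simp
  qed
  with module_hom_comp[OF s(1) \<psi>(1)] show thesis by (rule that)
qed

lemma dual_map_cocycle:
  assumes "partial_resolution R Q2 Q1 Q0 X d2 d1 e" "partial_resolution R Q2' Q1' Q0' X' d2' d1' e'"
    and "\<alpha>0 \<in> module_hom R Q0 Q0'" "\<alpha>1 \<in> module_hom R Q1 Q1'"
    and "\<And>x. x \<in> carrier Q1 \<Longrightarrow> d1' (\<alpha>1 x) = \<alpha>0 (d1 x)"
    and "\<psi> \<in> cocycles R Q2' Q1' d2'"
  shows "dual_map Q1 \<alpha>1 \<psi> \<in> cocycles R Q2 Q1 d2"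
proof -
  note Q = partial_resolutionD[OF assms(1)] and Q' = partial_resolutionD[OF assms(2)]
  have \<psi>: "\<psi> \<in> carrier (dual_module R Q1')" "\<And>y. y \<in> carrier Q2' \<Longrightarrow> \<psi> (d2' y) = \<zero>\<^bsub>R\<^esub>"
    using assms(6) by (auto simp: cocycles_iff)
  have "\<psi> (\<alpha>1 (d2 y)) = \<zero>\<^bsub>R\<^esub>" if y: "y \<in> carrier Q2" for y
  proof -
    have c: "d2 y \<in> carrier Q1" using module_hom_closed[OF Q(5) y] .
    then have "\<alpha>1 (d2 y) \<in> d2' ` carrier Q2'"
      unfolding Q'(8) using module_hom_closed[OF assms(4)] assms(5)[OF c] Q(11)[OF y]
        module_hom_zero[OF Q(3) Q'(3) assms(3)] by (auto simp: a_kernel_def')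
    then show ?thesis using \<psi>(2) by auto
  qed
  then show ?thesis
    using module_hom_closed[OF dual_map_hom[OF Q(2) Q'(2) assms(4)] \<psi>(1)] module_hom_closed[OF Q(5)]
    by (simp add: cocycles_iff)
qed

text \<open>
  Comparison maps \<open>\<alpha>\<close> and \<open>\<beta>\<close> in both directions induce maps between cocycles modulo
  coboundaries. By the homotopy argument pulling back along \<open>\<beta>\<^sub>1 \<circ> \<alpha>\<^sub>1\<close> or \<open>\<alpha>\<^sub>1 \<circ> \<beta>\<^sub>1\<close> does
  not change a class, so pulling back along \<open>\<beta>\<^sub>1\<close> alone is injective and surjective on classes.
\<close>

lemma Ext1_self_independent:
  assumes "partial_resolution R Q2 Q1 Q0 X d2 d1 e" "partial_resolution R Q2' Q1' Q0' X d2' d1' e'"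
    and "dual_basis R Q0 I0 b0 c0" "dual_basis R Q1 I1 b1 c1"
    and "dual_basis R Q0' I0' b0' c0'" "dual_basis R Q1' I1' b1' c1'"
  shows "module_isomorphic (op_ring R) (Ext1_self R Q2' Q1' Q0' d2' d1') (Ext1_self R Q2 Q1 Q0 d2 d1)"
proof -
  note Q = partial_resolutionD[OF assms(1)] and Q' = partial_resolutionD[OF assms(2)]
  interpret Q1: left_module R Q1 by (rule Q(2))
  have Rr: "left_module R (regular_module R)" by (rule left_module_regular[OF Q1.R.ring_axioms])
  obtain \<alpha>0 \<alpha>1 where a: "\<alpha>0 \<in> module_hom R Q0 Q0'" "\<alpha>1 \<in> module_hom R Q1 Q1'"
    "\<And>x. x \<in> carrier Q0 \<Longrightarrow> e' (\<alpha>0 x) = e x"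
    "\<And>x. x \<in> carrier Q1 \<Longrightarrow> d1' (\<alpha>1 x) = \<alpha>0 (d1 x)"
    using comparison_map[OF assms(1-4)] by blast
  obtain \<beta>0 \<beta>1 where b: "\<beta>0 \<in> module_hom R Q0' Q0" "\<beta>1 \<in> module_hom R Q1' Q1"
    "\<And>x. x \<in> carrier Q0' \<Longrightarrow> e (\<beta>0 x) = e' x"
    "\<And>x. x \<in> carrier Q1' \<Longrightarrow> d1 (\<beta>1 x) = \<beta>0 (d1' x)"
    using comparison_map[OF assms(2,1,5,6)] by blast
  note ac = module_hom_closed[OF a(1)] module_hom_closed[OF a(2)]
    and bc = module_hom_closed[OF b(1)] module_hom_closed[OF b(2)]
    and dc = module_hom_closed[OF Q(6)] module_hom_closed[OF Q'(6)]
  let ?Z = "cocycles R Q2 Q1 d2" and ?B = "coboundaries R Q1 Q0 d1"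
  let ?Z' = "cocycles R Q2' Q1' d2'" and ?B' = "coboundaries R Q1' Q0' d1'"
  let ?ZM = "(dual_module R Q1)\<lparr>carrier := ?Z\<rparr>" and ?ZM' = "(dual_module R Q1')\<lparr>carrier := ?Z'\<rparr>"
  note cob = coboundaries_iff[OF Q(2,3,6)] and cob' = coboundaries_iff[OF Q'(2,3,6)]
  note ZM = left_module_submodule[OF left_module_dual_module[OF Q(2)] cocycles_submodule[OF assms(1)]]
    and ZM' = left_module_submodule[OF left_module_dual_module[OF Q'(2)] cocycles_submodule[OF assms(2)]]
  note B = coboundaries_submodule[OF assms(1)] and B' = coboundaries_submodule[OF assms(2)]
  let ?E' = "quotient_module ?ZM' ?B'"
  have E': "left_module (op_ring R) ?E'" by (rule left_module_quotient_module[OF ZM' B'])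
  let ?T = "dual_map Q1' \<beta>1" and ?S = "dual_map Q1 \<alpha>1" and ?pr = "\<lambda>\<psi>. ?B' +>\<^bsub>?ZM'\<^esub> \<psi>"
  note pr = quotient_projection[OF ZM' B']
  have T: "?T \<in> module_hom (op_ring R) ?ZM ?ZM'"
  proof -
    have "?T \<psi> \<in> ?Z'" if "\<psi> \<in> ?Z" for \<psi>
      by (rule dual_map_cocycle[OF assms(2,1) b(1,2,4) that])
    then show ?thesis
      using dual_map_hom[OF Q'(2) Q(2) b(2)] by (auto simp: module_hom_def cocycles_iff)
  qed
  have TB: "?T \<psi> \<in> ?B' \<longleftrightarrow> \<psi> \<in> ?B" if \<psi>: "\<psi> \<in> ?Z" for \<psi>
  proof
    have \<psi>D: "\<psi> \<in> carrier (dual_module R Q1)" using \<psi> by (simp add: cocycles_iff)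
    assume "?T \<psi> \<in> ?B'"
    then obtain l where l: "l \<in> module_hom R Q0' (regular_module R)"
      "\<And>y. y \<in> carrier Q1' \<Longrightarrow> ?T \<psi> y = l (d1' y)"
      by (auto simp: cob')
    have "e (\<beta>0 (\<alpha>0 x)) = e x" if "x \<in> carrier Q0" for x
      using that ac a(3) b(3) by simp
    moreover have "d1 (\<beta>1 (\<alpha>1 x)) = \<beta>0 (\<alpha>0 (d1 x))" if "x \<in> carrier Q1" for x
      using that ac a(4) b(4) by simp
    ultimately obtain m where m: "m \<in> module_hom R Q0 (regular_module R)"
      "\<And>x. x \<in> carrier Q1 \<Longrightarrow> \<psi> (\<beta>1 (\<alpha>1 x)) \<ominus>\<^bsub>R\<^esub> \<psi> x = m (d1 x)"
      using self_map_preserves_class[OF assms(1,3) module_hom_comp[OF a(1) b(1)]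
          module_hom_comp[OF a(2) b(2)] _ _ \<psi>] by blast
    have "\<psi> x = l (\<alpha>0 (d1 x)) \<ominus>\<^bsub>R\<^esub> m (d1 x)" if x: "x \<in> carrier Q1" for x
    proof -
      have lx: "\<psi> (\<beta>1 (\<alpha>1 x)) = l (\<alpha>0 (d1 x))"
        using l(2)[OF ac(2)[OF x]] ac(2)[OF x] a(4)[OF x] by simp
      have c: "\<psi> x \<in> carrier R" "\<psi> (\<beta>1 (\<alpha>1 x)) \<in> carrier R"
        using dual_functional_closed[OF \<psi>D] x ac bc by auto
      then have "\<psi> x = \<psi> (\<beta>1 (\<alpha>1 x)) \<ominus>\<^bsub>R\<^esub> (\<psi> (\<beta>1 (\<alpha>1 x)) \<ominus>\<^bsub>R\<^esub> \<psi> x)"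
        by (simp add: a_minus_def Q1.R.minus_add Q1.R.r_neg2)
      then show ?thesis unfolding m(2)[OF x] unfolding lx .
    qed
    moreover have "(\<lambda>z. l (\<alpha>0 z) \<ominus>\<^bsub>R\<^esub> m z) \<in> module_hom R Q0 (regular_module R)"
      using module_hom_pointwise_diff[OF Q(3) Rr module_hom_comp[OF a(1) l(1)] m(1)] by simp
    ultimately show "\<psi> \<in> ?B"
      unfolding cob using \<psi>D by (intro conjI bexI[of _ "\<lambda>z. l (\<alpha>0 z) \<ominus>\<^bsub>R\<^esub> m z"] ballI)
  next
    assume "\<psi> \<in> ?B"
    then obtain l where l: "l \<in> module_hom R Q0 (regular_module R)"
      "\<And>x. x \<in> carrier Q1 \<Longrightarrow> \<psi> x = l (d1 x)"
      by (auto simp: cob)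
    have "?T \<psi> y = l (\<beta>0 (d1' y))" if "y \<in> carrier Q1'" for y
      using that l(2) bc b(4) by simp
    moreover have "?T \<psi> \<in> carrier (dual_module R Q1')"
      using module_hom_closed[OF T, of \<psi>] \<psi> by (simp add: cocycles_iff)
    ultimately show "?T \<psi> \<in> ?B'"
      unfolding cob' using module_hom_comp[OF b(1) l(1)]
      by (intro conjI bexI[of _ "\<lambda>z. l (\<beta>0 z)"] ballI)
  qed
  have kernel: "a_kernel ?ZM ?E' (\<lambda>\<psi>. ?pr (?T \<psi>)) = ?B"
  proof (intro equalityI subsetI)
    fix \<psi> assume "\<psi> \<in> a_kernel ?ZM ?E' (\<lambda>\<psi>. ?pr (?T \<psi>))"
    then have z: "\<psi> \<in> ?Z" "?pr (?T \<psi>) = \<zero>\<^bsub>?E'\<^esub>" by (auto simp: a_kernel_def')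
    then have "?T \<psi> \<in> a_kernel ?ZM' ?E' ?pr"
      using module_hom_closed[OF T] by (simp add: a_kernel_def')
    then show "\<psi> \<in> ?B" unfolding pr(3) using TB[OF z(1)] by simp
  next
    fix \<psi> assume \<psi>: "\<psi> \<in> ?B"
    then have z: "\<psi> \<in> ?Z" using submoduleD(1)[OF B] by auto
    have "?T \<psi> \<in> a_kernel ?ZM' ?E' ?pr" unfolding pr(3) using TB[OF z] \<psi> by simp
    then show "\<psi> \<in> a_kernel ?ZM ?E' (\<lambda>\<psi>. ?pr (?T \<psi>))" using z by (simp add: a_kernel_def')
  qed
  have surj: "(\<lambda>\<psi>. ?pr (?T \<psi>)) ` carrier ?ZM = carrier ?E'"
  proof (intro equalityI subsetI)
    fix C assume "C \<in> carrier ?E'"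
    then obtain \<psi> where \<psi>: "\<psi> \<in> ?Z'" "C = ?pr \<psi>" unfolding pr(2)[symmetric] by auto
    have \<psi>D: "\<psi> \<in> carrier (dual_module R Q1')" using \<psi>(1) by (simp add: cocycles_iff)
    have S: "?S \<psi> \<in> ?Z" by (rule dual_map_cocycle[OF assms(1,2) a(1,2,4) \<psi>(1)])
    have TS: "?T (?S \<psi>) \<in> ?Z'" using module_hom_closed[OF T, of "?S \<psi>"] S by simp
    then have TSD: "?T (?S \<psi>) \<in> carrier (dual_module R Q1')" by (simp add: cocycles_iff)
    have "e' (\<alpha>0 (\<beta>0 x)) = e' x" if "x \<in> carrier Q0'" for x
      using that bc a(3) b(3) by simp
    moreover have "d1' (\<alpha>1 (\<beta>1 x)) = \<alpha>0 (\<beta>0 (d1' x))" if "x \<in> carrier Q1'" for x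
      using that bc a(4) b(4) by simp
    ultimately obtain m where m: "m \<in> module_hom R Q0' (regular_module R)"
      "\<And>x. x \<in> carrier Q1' \<Longrightarrow> \<psi> (\<alpha>1 (\<beta>1 x)) \<ominus>\<^bsub>R\<^esub> \<psi> x = m (d1' x)"
      using self_map_preserves_class[OF assms(2,5) module_hom_comp[OF b(1) a(1)]
          module_hom_comp[OF b(2) a(2)] _ _ \<psi>(1)] by blast
    have eq: "?T (?S \<psi>) \<ominus>\<^bsub>?ZM'\<^esub> \<psi> = ?T (?S \<psi>) \<ominus>\<^bsub>dual_module R Q1'\<^esub> \<psi>"
      using module_hom_diff[OF ZM' left_module_dual_module[OF Q'(2)]
          module_hom_inclusion[OF submoduleD(1)[OF cocycles_submodule[OF assms(2)]]]] TS \<psi>(1)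
      by simp
    interpret D': left_module "op_ring R" "dual_module R Q1'" by (rule left_module_dual_module[OF Q'(2)])
    have "(?T (?S \<psi>) \<ominus>\<^bsub>dual_module R Q1'\<^esub> \<psi>) x = m (d1' x)" if x: "x \<in> carrier Q1'" for x
      using dual_minus_apply[OF Q'(2) TSD \<psi>D x] m(2)[OF x] x bc by simp
    then have "?T (?S \<psi>) \<ominus>\<^bsub>dual_module R Q1'\<^esub> \<psi> \<in> ?B'"
      unfolding cob' using m(1) TSD \<psi>D by (intro conjI bexI[of _ m] ballI D'.M.minus_closed)
    then have "?T (?S \<psi>) \<ominus>\<^bsub>?ZM'\<^esub> \<psi> \<in> a_kernel ?ZM' ?E' ?pr" unfolding pr(3) eq .
    then have "?pr (?T (?S \<psi>)) = ?pr \<psi>"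
      using module_hom_eq_iff_diff_in_kernel[OF ZM' E' pr(1)] TS \<psi>(1) by simp
    then show "C \<in> (\<lambda>\<psi>. ?pr (?T \<psi>)) ` carrier ?ZM"
      using \<psi>(2) S by (intro image_eqI[of _ _ "?S \<psi>"]) simp_all
  qed (use module_hom_closed[OF module_hom_comp[OF T pr(1)]] in auto)
  show ?thesis
    unfolding Ext1_self_eq
    by (rule first_isomorphism[OF ZM E' module_hom_comp[OF T pr(1)] surj kernel])
qed

section \<open>The first extension module of the transpose\<close>

text \<open>
  Left exactness of the dual: a functional on \<open>P0\<close> that vanishes on the image of \<open>f\<close>, which is
  the kernel of \<open>g\<close>, factors through \<open>M\<close>. The rest is the definition of the transpose.
\<close>

lemma dual_presentation_partial_resolution:
  assumes "left_module R M" "projective_presentation R P1 P0 M f g"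
  shows "partial_resolution (op_ring R) (dual_module R M) (dual_module R P0) (dual_module R P1)
    (transpose_module R P1 P0 f) (dual_map P0 g) (dual_map P1 f)
    (\<lambda>\<chi>. (dual_map P1 f ` carrier (dual_module R P0)) +>\<^bsub>dual_module R P1\<^esub> \<chi>)"
proof -
  have P: "left_module R P1" "left_module R P0" "f \<in> module_hom R P1 P0" "g \<in> module_hom R P0 M"
    "f ` carrier P1 = a_kernel P0 M g" "g ` carrier P0 = carrier M"
    using assms(2) by (simp_all add: projective_presentation_def projective_module_def)
  have Rr: "left_module R (regular_module R)"
    by (rule left_module_regular[OF ring_of_left_module[OF assms(1)]])
  note D = left_module_dual_module[OF assms(1)] left_module_dual_module[OF P(2)]
    left_module_dual_module[OF P(1)]
  note f' = dual_map_hom[OF P(1,2,3)] and g' = dual_map_hom[OF P(2) assms(1) P(4)]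
  have sub: "submodule (dual_map P1 f ` carrier (dual_module R P0)) (op_ring R) (dual_module R P1)"
    by (rule submodule_image[OF D(2,3) f'])
  have "dual_map P0 g ` carrier (dual_module R M) =
      a_kernel (dual_module R P0) (dual_module R P1) (dual_map P1 f)"
  proof (intro equalityI subsetI)
    fix \<chi> assume "\<chi> \<in> dual_map P0 g ` carrier (dual_module R M)"
    then obtain \<phi> where \<phi>: "\<phi> \<in> carrier (dual_module R M)" "\<chi> = dual_map P0 g \<phi>" by auto
    have "\<chi> (f q) = \<zero>\<^bsub>R\<^esub>" if q: "q \<in> carrier P1" for q
    proof -
      have "g (f q) = \<zero>\<^bsub>M\<^esub>" using P(5) q by (auto simp: a_kernel_def')
      then show ?thesis
        using \<phi>(2) module_hom_closed[OF P(3) q] module_hom_zero[OF assms(1) Rr dual_functional[OF \<phi>(1)]]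
        by simp
    qed
    then have "\<chi> \<in> cocycles R P1 P0 f"
      using \<phi> module_hom_closed[OF g'] by (simp add: cocycles_iff)
    then show "\<chi> \<in> a_kernel (dual_module R P0) (dual_module R P1) (dual_map P1 f)"
      by (simp add: cocycles_def)
  next
    fix \<chi> assume "\<chi> \<in> a_kernel (dual_module R P0) (dual_module R P1) (dual_map P1 f)"
    then have \<chi>: "\<chi> \<in> carrier (dual_module R P0)" "\<And>q. q \<in> carrier P1 \<Longrightarrow> \<chi> (f q) = \<zero>\<^bsub>R\<^esub>"
      by (auto simp flip: cocycles_def simp: cocycles_iff)
    have "\<chi> p = \<zero>\<^bsub>regular_module R\<^esub>" if "p \<in> a_kernel P0 M g" for p
      using that \<chi>(2) unfolding P(5)[symmetric] by auto
    then obtain k where k: "k \<in> module_hom R M (regular_module R)"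
      "\<And>p. p \<in> carrier P0 \<Longrightarrow> k (g p) = \<chi> p"
      using module_hom_factors_through_surjection[OF P(2) assms(1) Rr P(4,6) dual_functional[OF \<chi>(1)]]
      by blast
    have k': "restrict k (carrier M) \<in> carrier (dual_module R M)"
      by (rule restrict_functional_in_dual[OF assms(1) k(1)])
    have "\<chi> = dual_map P0 g (restrict k (carrier M))"
      using k(2) module_hom_closed[OF P(4)]
      by (intro dual_eqI[OF \<chi>(1) module_hom_closed[OF g' k']]) simp
    with k' show "\<chi> \<in> dual_map P0 g ` carrier (dual_module R M)" by blast
  qed
  with D f' g' quotient_projection[OF D(3) sub] left_module_quotient_module[OF D(3) sub]
  show ?thesis unfolding partial_resolution_def transpose_module_def by blast
qed

text \<open>
  Evaluation identifies \<open>P0\<close> with its bidual. Under this identification a cocycle is an element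
  \<open>p\<close> with \<open>\<phi> (g p) = 0\<close> for all \<open>\<phi> \<in> M*\<close>, so \<open>g\<close> maps the cocycles onto the reject. Because
  \<open>P1\<close> too is its own bidual, the coboundaries are the image of \<open>f\<close>, which is the kernel
  of \<open>g\<close>.
\<close>

lemma reject_isomorphic_Ext1_dual_presentation:
  assumes "left_module R M" "projective_presentation R P1 P0 M f g"
    and "dual_basis R P1 I1 b1 c1" "finite I1" "dual_basis R P0 I0 b0 c0" "finite I0"
    and "submodule (reject R M) R M"
  shows "module_isomorphic R (M\<lparr>carrier := reject R M\<rparr>)
    (Ext1_self (op_ring R) (dual_module R M) (dual_module R P0) (dual_module R P1)
      (dual_map P0 g) (dual_map P1 f))"
proof -
  have P: "left_module R P1" "left_module R P0" "f \<in> module_hom R P1 P0" "g \<in> module_hom R P0 M"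
    "f ` carrier P1 = a_kernel P0 M g" "g ` carrier P0 = carrier M"
    using assms(2) by (simp_all add: projective_presentation_def projective_module_def)
  note res = dual_presentation_partial_resolution[OF assms(1,2)]
  let ?Z = "cocycles (op_ring R) (dual_module R M) (dual_module R P0) (dual_map P0 g)"
  let ?B = "coboundaries (op_ring R) (dual_module R P0) (dual_module R P1) (dual_map P1 f)"
  let ?N = "M\<lparr>carrier := reject R M\<rparr>" and ?ZM = "(bidual R P0)\<lparr>carrier := ?Z\<rparr>"
  have N: "left_module R ?N" by (rule left_module_submodule[OF assms(1,7)])
  have Zsub: "submodule ?Z R (bidual R P0)" using cocycles_submodule[OF res] by simp
  have ZM: "left_module R ?ZM" by (rule left_module_submodule[OF left_module_bidual[OF P(2)] Zsub])
  let ?ev = "evaluation R P0"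
  note bij = evaluation_bijective[OF P(2) assms(5,6)]
  have evZ: "?ev p \<in> ?Z \<longleftrightarrow> g p \<in> reject R M" if p: "p \<in> carrier P0" for p
  proof -
    have "?ev p (dual_map P0 g \<phi>) = \<phi> (g p)" if \<phi>: "\<phi> \<in> carrier (dual_module R M)" for \<phi>
      using p module_hom_closed[OF dual_map_hom[OF P(2) assms(1) P(4)] \<phi>] by (simp add: evaluation_def)
    then show ?thesis
      using module_hom_closed[OF evaluation_hom[OF P(2)] p] module_hom_closed[OF P(4) p]
      by (auto simp: cocycles_iff reject_def)
  qed
  have evB: "?ev p \<in> ?B \<longleftrightarrow> g p = \<zero>\<^bsub>M\<^esub>" if p: "p \<in> carrier P0" for p
  proof -
    \<comment> \<open>under evaluation the double dual of \<open>f\<close> corresponds to \<open>f\<close>\<close>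
    have ev_f: "dual_map (dual_module R P0) (dual_map P1 f) (evaluation R P1 q) = ?ev (f q)"
      if q: "q \<in> carrier P1" for q
      using q module_hom_closed[OF P(3)] module_hom_closed[OF dual_map_hom[OF P(1,2,3)]]
      by (auto simp: dual_map_def[of "dual_module R P0"] compose_def evaluation_def intro!: restrict_ext)
    have "?B = (\<lambda>q. ?ev (f q)) ` carrier P1"
      unfolding coboundaries_def bij_betw_imp_surj_on[OF evaluation_bijective[OF P(1) assms(3,4)], symmetric]
      unfolding image_image using ev_f by (rule image_cong[OF refl])
    also have "\<dots> = ?ev ` a_kernel P0 M g" unfolding P(5)[symmetric] image_image ..
    finally show ?thesis
      using p bij by (auto simp: a_kernel_def' bij_betw_def inj_on_def)
  qed
  let ?r = "inv_into (carrier P0) ?ev"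
  have r: "?r \<in> module_hom R (bidual R P0) P0"
    by (rule module_hom_inverse[OF P(2) evaluation_hom[OF P(2)] bij])
  have r_ev: "?r (?ev p) = p" if "p \<in> carrier P0" for p
    using bij that by (simp add: bij_betw_def)
  have ev_r: "\<exists>p\<in>carrier P0. \<theta> = ?ev p" if "\<theta> \<in> ?Z" for \<theta>
    using that bij submoduleD(1)[OF Zsub] by (auto simp: bij_betw_def)
  note k0 = module_hom_comp[OF module_hom_comp[OF module_hom_inclusion[OF submoduleD(1)[OF Zsub]] r] P(4)]
  have "g (?r \<theta>) \<in> reject R M" if "\<theta> \<in> ?Z" for \<theta>
    using ev_r[OF that] that evZ r_ev by auto
  then have k: "(\<lambda>\<theta>. g (?r \<theta>)) \<in> module_hom R ?ZM ?N"
    using k0 by (auto simp: module_hom_def)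
  have surj: "(\<lambda>\<theta>. g (?r \<theta>)) ` carrier ?ZM = carrier ?N"
  proof (intro equalityI subsetI)
    fix m assume "m \<in> carrier ?N"
    then have m: "m \<in> reject R M" by simp
    then obtain p where p: "p \<in> carrier P0" "m = g p" using P(6) by (auto simp: reject_def)
    then show "m \<in> (\<lambda>\<theta>. g (?r \<theta>)) ` carrier ?ZM"
      using evZ[OF p(1)] r_ev[OF p(1)] m by (intro image_eqI[of _ _ "?ev p"]) simp_all
  qed (use module_hom_closed[OF k] in auto)
  have kernel: "a_kernel ?ZM ?N (\<lambda>\<theta>. g (?r \<theta>)) = ?B"
  proof (intro equalityI subsetI)
    fix \<theta> assume "\<theta> \<in> a_kernel ?ZM ?N (\<lambda>\<theta>. g (?r \<theta>))"
    then have t: "\<theta> \<in> ?Z" "g (?r \<theta>) = \<zero>\<^bsub>M\<^esub>" by (auto simp: a_kernel_def')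
    obtain p where "p \<in> carrier P0" "\<theta> = ?ev p" using ev_r[OF t(1)] by auto
    with t evB r_ev show "\<theta> \<in> ?B" by simp
  next
    fix \<theta> assume B: "\<theta> \<in> ?B"
    then have Z: "\<theta> \<in> ?Z" using submoduleD(1)[OF coboundaries_submodule[OF res]] by auto
    obtain p where "p \<in> carrier P0" "\<theta> = ?ev p" using ev_r[OF Z] by auto
    with Z B evB r_ev show "\<theta> \<in> a_kernel ?ZM ?N (\<lambda>\<theta>. g (?r \<theta>))" by (simp add: a_kernel_def')
  qed
  show ?thesis
    unfolding Ext1_self_eq by (rule first_isomorphism[OF ZM N k surj kernel])
qed

lemma finitely_generated_projective_dual_basis:
  fixes P :: "('a, 'b, 'm) module_scheme"
  assumes "projective_module R P" "finitely_generated R P"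
  obtains I :: "'b set" and b c where "finite I" "dual_basis R P I b c"
proof -
  have P: "left_module R P" using assms(1) by (simp add: projective_module_def)
  obtain I :: "'b set" and b c where "dual_basis R P I b c"
    using projective_module_dual_basis[OF assms(1)] by blast
  from finitely_generated_finite_dual_basis[OF P this assms(2)] that show thesis by blast
qed

lemma reject_isomorphic_Ext1_transpose:
  fixes P1 :: "('a, 'p, 'm1) module_scheme" and P0 :: "('a, 'q, 'm0) module_scheme"
    and Q1 :: "('a, 'q1, 'n1) module_scheme" and Q0 :: "('a, 'q0, 'n0) module_scheme"
  assumes "left_module R M" "submodule (reject R M) R M"
    and "projective_presentation R P1 P0 M f g"
    and "projective_resolution2 (op_ring R) Q2 Q1 Q0 (transpose_module R P1 P0 f) d2 d1 e"
  shows "module_isomorphic R (M\<lparr>carrier := reject R M\<rparr>) (Ext1_self (op_ring R) Q2 Q1 Q0 d2 d1)"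
proof -
  have P: "projective_module R P1" "projective_module R P0" "finitely_generated R P1"
    "finitely_generated R P0" "left_module R P1" "left_module R P0"
    using assms(3) by (simp_all add: projective_presentation_def projective_module_def)
  obtain I1 :: "'p set" and b1 c1 where bas1: "finite I1" "dual_basis R P1 I1 b1 c1"
    using finitely_generated_projective_dual_basis[OF P(1,3)] by blast
  obtain I0 :: "'q set" and b0 c0 where bas0: "finite I0" "dual_basis R P0 I0 b0 c0"
    using finitely_generated_projective_dual_basis[OF P(2,4)] by blast
  note res = dual_presentation_partial_resolution[OF assms(1,3)]
  have "partial_resolution (op_ring R) Q2 Q1 Q0 (transpose_module R P1 P0 f) d2 d1 e"
    using assms(4) partial_resolutionD(4)[OF res]
    by (simp add: projective_resolution2_def partial_resolution_def projective_module_def)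
  moreover obtain J0 :: "'q0 set" and u0 v0 where "dual_basis (op_ring R) Q0 J0 u0 v0"
    using projective_module_dual_basis[of "op_ring R" Q0] assms(4)
    by (auto simp: projective_resolution2_def)
  moreover obtain J1 :: "'q1 set" and u1 v1 where "dual_basis (op_ring R) Q1 J1 u1 v1"
    using projective_module_dual_basis[of "op_ring R" Q1] assms(4)
    by (auto simp: projective_resolution2_def)
  moreover note dual_basis_of_dual[OF P(5) finite_dual_basis_evaluation_basis[OF P(5) bas1(2,1)]]
    dual_basis_of_dual[OF P(6) finite_dual_basis_evaluation_basis[OF P(6) bas0(2,1)]]
  ultimately have "module_isomorphic R
    (Ext1_self (op_ring R) (dual_module R M) (dual_module R P0) (dual_module R P1)
      (dual_map P0 g) (dual_map P1 f)) (Ext1_self (op_ring R) Q2 Q1 Q0 d2 d1)"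
    using Ext1_self_independent[OF _ res] by simp
  with reject_isomorphic_Ext1_dual_presentation[OF assms(1,3) bas1(2,1) bas0(2,1) assms(2)]
  show ?thesis by (rule module_isomorphic_trans)
qed

theorem theorem3p10:
  fixes R :: "('a, 'r) ring_scheme"
    and M :: "('a, 'b, 'm) module_scheme"
  assumes "ring R"
    and "left_semihereditary R"
    and "right_module R M"
    and "finitely_presented (op_ring R) M"
  shows "\<exists>P N.
    direct_decomposition (op_ring R) M P N \<and>
    projective_module (op_ring R) (M\<lparr>carrier := P\<rparr>) \<and>
    stable_module (op_ring R) (M\<lparr>carrier := N\<rparr>) \<and>
    module_isomorphic (op_ring R) (M\<lparr>carrier := P\<rparr>)
      (dual_module R (dual_module (op_ring R) M)) \<and>
    (\<forall>(P1 :: ('a, 'p) module) (P0 :: ('a, 'q) module) f g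
      (Q2 :: ('a, 'q2) module) (Q1 :: ('a, 'q1) module) (Q0 :: ('a, 'q0) module) d2 d1 e.
      projective_presentation (op_ring R) P1 P0 M f g \<longrightarrow>
      projective_resolution2 R Q2 Q1 Q0 (transpose_module (op_ring R) P1 P0 f) d2 d1 e \<longrightarrow>
      module_isomorphic (op_ring R) (M\<lparr>carrier := N\<rparr>) (Ext1_self R Q2 Q1 Q0 d2 d1))"
proof -
  have "left_semihereditary (op_ring (op_ring R))" using assms(2) by simp
  from finitely_presented_evaluation_basis[OF this assms(3,4)]
  obtain I :: "nat set" and x \<phi> where "evaluation_basis (op_ring R) M I x \<phi>" by blast
  from evaluation_basis_splits[OF assms(3) this]
  obtain P where P: "direct_decomposition (op_ring R) M P (reject (op_ring R) M)"
    "projective_module (op_ring R) (M\<lparr>carrier := P\<rparr>)"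
    "module_isomorphic (op_ring R) (M\<lparr>carrier := P\<rparr>) (dual_module R (dual_module (op_ring R) M))"
    by auto
  moreover note stable_reject[OF assms(3) P(1)]
  moreover have "submodule (reject (op_ring R) M) (op_ring R) M"
    using P(1) by (simp add: direct_decomposition_def)
  note reject_isomorphic_Ext1_transpose[OF assms(3) this, simplified]
  ultimately show ?thesis by blast
qed

end
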